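(* Let $l\in(0,\pi]$, let $m^+,m^-$ be probability measures on $[0,1]$ with mean $\frac12$, and let $(K^{m^+,m^-},W)$ be the flow of kernels on $\mathscr C$ and Brownian motion constructed in the context. (1) There exists an increasing sequence $(S_k)_{k\ge1}$ of $(\mathcal F^W_{0,t})_{t\ge0}$-stopping times such that a.s. $\lim_{k\to\infty}S_k=+\infty$ and $K^{m^+,m^-}_{0,S_k}(z)=\delta_{e^{il}}$ for all $z\in\mathscr C$ and all $k\ge1$. (2) There exists an increasing sequence $(T_k)_{k\ge1}$ of $(\mathcal F^W_{0,t})_{t\ge0}$-stopping times such that a.s. $\lim_{k\to\infty}T_k=+\infty$ and $K^{m^+,m^-}_{0,T_k}(z)=\delta_{1}$ for all $z\in\mathscr C$ and all $k\ge1$.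
   Context: $\mathscr C=\{z\in\mathbb C:|z|=1\}$; $\arg(z)\in[0,2\pi)$; $\epsilon(z)=1$ if $\arg(z)\in[0,l]$ and $\epsilon(z)=-1$ if $\arg(z)\in(l,2\pi)$. Kernels on $\mathscr C$ are measurable maps $\mathscr C\to\mathcal P(\mathscr C)$, composed by $K_1K_2(x)=\int K_1(x,dy)K_2(y)$. Construction of $(K^{m^+,m^-},W)$. By Kolmogorov's extension theorem take a process $(U^+_{s,t},U^-_{s,t},W_{s,t})_{s\le t}$ with values in $[0,1]^2\times\mathbb R$ such that: (i) $W_{s,t}=W_t-W_s$ with $W$ a Brownian motion on $\mathbb R$ (i.e. $(W_t)_{t\ge0}$, $(W_{-t})_{t\ge0}$ are independent standard Brownian motions); (ii) given $W$, $(U^+_{s,t})_{s\le t}$ and $(U^-_{s,t})_{s\le t}$ are independent; (iii) for fixed $s<t$, $U^\pm_{s,t}$ is independent of $W$ with law $m^\pm$; (iv) with $M^+_{s,t}=\inf_{u\in[s,t]}W_u$ and $M^-_{s,t}=\sup_{u\in[s,t]}W_u$, for all $s<t$, $u<v$: $U^\pm_{s,t}=U^\pm_{u,v}$ a.s. on $\{M^\pm_{s,t}=M^\pm_{u,v}\}$; (v) for $s<t$ and $s_i<t_i$ ($1\le i\le n$), the law of $U^\pm_{s,t}$ given $(U^\pm_{s_i,t_i})_{i\le n}$ and $W$ is $m^\pm$ when $M^\pm_{s,t}\notin\{M^\pm_{s_i,t_i}:1\le i\le n\}$, and is $\delta_{U^\pm_{s_i,t_i}}$ on $\{M^\pm_{s,t}=M^\pm_{s_i,t_i}\}$.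 Then replace $U^\pm_{s,t}$, simultaneously for all $s<t$, by its modification $\limsup_{n\to\infty}U^\pm_{s_n,t_n}$ with $s_n=\frac{\lfloor ns\rfloor+1}{n}$, $t_n=\frac{\lfloor nt\rfloor-1}{n}$, still denoted $U^\pm_{s,t}$. Let $W^+_{s,t}=W_t-\inf_{[s,t]}W$, $W^-_{s,t}=\sup_{[s,t]}W-W_t$, $\rho_s=\inf\{r\ge s:\sup(W^+_{s,r},W^-_{s,r})=l\}$, and $\tau_s(z)=\inf\{r\ge s: ze^{i\epsilon(z)W_{s,r}}\in\{1,e^{il}\}\}$. For $t\in[s,\rho_s]$ set $K_{s,t}(1)=U^+_{s,t}\delta_{\exp(iW^+_{s,t})}+(1-U^+_{s,t})\delta_{\exp(-iW^+_{s,t})}$, $K_{s,t}(e^{il})=U^-_{s,t}\delta_{\exp(i(l+W^-_{s,t}))}+(1-U^-_{s,t})\delta_{\exp(i(l-W^-_{s,t}))}$, and for $z\notin\{1,e^{il}\}$: $K_{s,t}(z)=\delta_{ze^{i\epsilon(z)W_{s,t}}}$ if $t\le\tau_s(z)$, while if $t>\tau_s(z)$, $K_{s,t}(z)=K_{s,t}(1)$ when $ze^{i\epsilon(z)W_{s,\tau_s(z)}}=1$ and $K_{s,t}(z)=K_{s,t}(e^{il})$ when $ze^{i\epsilon(z)W_{s,\tau_s(z)}}=e^{il}$. With $\rho^0_s=s$, $\rho^{k+1}_s=\rho_{\rho^k_s}$, for all $s\le t$ set $K^{m^+,m^-}_{s,t}=\sum_{k\ge0}1_{\{\rho^k_s\le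 t<\rho^{k+1}_s\}}K_{s,\rho_s}K_{\rho_s,\rho^2_s}\cdots K_{\rho^{k-1}_s,\rho^k_s}K_{\rho^k_s,t}$. $\mathcal F^W_{s,t}=\sigma(W_{u,v}:\ s\le u\le v\le t)$. *)

theory Defs
  imports "HOL-Probability.Probability"
begin

section \<open>Probabilistic notions\<close>

definition sigma_gen :: "'a set \<Rightarrow> 'i set \<Rightarrow> ('i \<Rightarrow> 'a \<Rightarrow> real) \<Rightarrow> 'a measure" where
  "sigma_gen \<Omega> I X = sigma \<Omega> (\<Union>i\<in>I. {X i -` A \<inter> \<Omega> | A. A \<in> sets borel})"

definition (in prob_space) cond_indep :: "'a measure \<Rightarrow> 'a measure \<Rightarrow> 'a measure \<Rightarrow> bool" where
  "cond_indep F G H \<longleftrightarrow>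
     (\<forall>A\<in>sets G. \<forall>B\<in>sets H. AE \<omega> in M.
        real_cond_exp M F (indicator (A \<inter> B)) \<omega> =
        real_cond_exp M F (indicator A) \<omega> * real_cond_exp M F (indicator B) \<omega>)"

text \<open>Paths are continuous for every sample point, not just almost surely, because the
  filtration \<open>FW\<close> below is not completed.\<close>

definition (in prob_space) standard_brownian_motion :: "(real \<Rightarrow> 'a \<Rightarrow> real) \<Rightarrow> bool" where
  "standard_brownian_motion B \<longleftrightarrow>
     (\<forall>t\<ge>0. B t \<in> borel_measurable M) \<and>
     (\<forall>\<omega>\<in>space M. B 0 \<omega> = 0) \<and>
     (\<forall>\<omega>\<in>space M. continuous_on {0..} (\<lambda>t. B t \<omega>)) \<and>
     (\<forall>s t. 0 \<le> s \<and> s < t \<longrightarrow>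
        distributed M lborel (\<lambda>\<omega>. B t \<omega> - B s \<omega>) (normal_density 0 (sqrt (t - s)))) \<and>
     (\<forall>(n::nat) (t::nat \<Rightarrow> real). 0 \<le> t 0 \<and> (\<forall>i<n. t i \<le> t (Suc i)) \<longrightarrow>
        indep_vars (\<lambda>_. borel) (\<lambda>i \<omega>. B (t (Suc i)) \<omega> - B (t i) \<omega>) {..<n})"

definition (in prob_space) brownian_motion_on_line :: "(real \<Rightarrow> 'a \<Rightarrow> real) \<Rightarrow> bool" where
  "brownian_motion_on_line W \<longleftrightarrow>
     standard_brownian_motion W \<and>
     standard_brownian_motion (\<lambda>t. W (- t)) \<and>
     indep_set (sets (sigma_gen (space M) {0..} W))
               (sets (sigma_gen (space M) {0..} (\<lambda>t. W (- t))))"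

text \<open>The upper index may be infinite, so that \<open>FW\<close> can be used with stopping times that take
  the value infinity.\<close>

definition FW :: "'a set \<Rightarrow> (real \<Rightarrow> 'a \<Rightarrow> real) \<Rightarrow> real \<Rightarrow> ereal \<Rightarrow> 'a measure" where
  "FW \<Omega> W s t =
     sigma_gen \<Omega> {(u, v). s \<le> u \<and> u \<le> v \<and> ereal v \<le> t} (\<lambda>(u, v) \<omega>. W v \<omega> - W u \<omega>)"


section \<open>The driving processes\<close>

definition unit_interval :: "real measure" where
  "unit_interval = restrict_space borel {0..1}"

definition path_inf :: "(real \<Rightarrow> real) \<Rightarrow> real \<Rightarrow> real \<Rightarrow> real" where
  "path_inf w s t = (INF u\<in>{s..t}. w u)"

definition path_sup :: "(real \<Rightarrow> real) \<Rightarrow> real \<Rightarrow> real \<Rightarrow> real" where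
  "path_sup w s t = (SUP u\<in>{s..t}. w u)"

text \<open>The requirements on one of the processes \<open>U\<^sup>+\<close>, \<open>U\<^sup>-\<close>; the argument \<open>ext\<close> is \<open>path_inf\<close>
  for \<open>U\<^sup>+\<close> and \<open>path_sup\<close> for \<open>U\<^sup>-\<close>. In the last two clauses the conditional law of \<open>U s t\<close> is
  given by the conditional probabilities of the events \<open>U s t \<in> B\<close>.\<close>

definition (in prob_space) splitting_process ::
  "((real \<Rightarrow> real) \<Rightarrow> real \<Rightarrow> real \<Rightarrow> real) \<Rightarrow> real measure \<Rightarrow> (real \<Rightarrow> 'a \<Rightarrow> real)
   \<Rightarrow> (real \<Rightarrow> real \<Rightarrow> 'a \<Rightarrow> real) \<Rightarrow> bool" where
  "splitting_process ext m W U \<longleftrightarrow>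
     (let E = (\<lambda>s t \<omega>. ext (\<lambda>r. W r \<omega>) s t);
          SW = sigma_gen (space M) UNIV W
      in
        (\<forall>s t. s \<le> t \<longrightarrow> U s t \<in> M \<rightarrow>\<^sub>M unit_interval) \<and>
        (\<forall>s t. s < t \<longrightarrow>
           indep_set (sets (sigma_gen (space M) {()} (\<lambda>_. U s t))) (sets SW) \<and>
           distr M unit_interval (U s t) = m) \<and>
        (\<forall>s t u v. s < t \<and> u < v \<longrightarrow>
           (AE \<omega> in M. E s t \<omega> = E u v \<omega> \<longrightarrow> U s t \<omega> = U u v \<omega>)) \<and>
        (\<forall>s t (n::nat) (a::nat \<Rightarrow> real) (b::nat \<Rightarrow> real).
           s < t \<and> 1 \<le> n \<and> (\<forall>i<n. a i < b i) \<longrightarrow>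
           (let G = sigma (space M)
                      (sets (sigma_gen (space M) {..<n} (\<lambda>i. U (a i) (b i))) \<union> sets SW)
            in \<forall>B\<in>sets unit_interval.
                 (AE \<omega> in M. E s t \<omega> \<notin> {E (a i) (b i) \<omega> | i. i < n} \<longrightarrow>
                    real_cond_exp M G (indicator {\<omega>\<in>space M. U s t \<omega> \<in> B}) \<omega> = measure m B) \<and>
                 (\<forall>i<n. AE \<omega> in M. E s t \<omega> = E (a i) (b i) \<omega> \<longrightarrow>
                    real_cond_exp M G (indicator {\<omega>\<in>space M. U s t \<omega> \<in> B}) \<omega> =
                      measure (return unit_interval (U (a i) (b i) \<omega>)) B))))"

definition (in prob_space) driving_processes ::
  "real measure \<Rightarrow> real measure \<Rightarrow> (real \<Rightarrow> real \<Rightarrow> 'a \<Rightarrow> real) \<Rightarrow> (real \<Rightarrow> real \<Rightarrow> 'a \<Rightarrow> real)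
   \<Rightarrow> (real \<Rightarrow> 'a \<Rightarrow> real) \<Rightarrow> bool" where
  "driving_processes mp mm Up Um W \<longleftrightarrow>
     brownian_motion_on_line W \<and>
     cond_indep (sigma_gen (space M) UNIV W)
                (sigma_gen (space M) {(s, t). s \<le> t} (\<lambda>(s, t). Up s t))
                (sigma_gen (space M) {(s, t). s \<le> t} (\<lambda>(s, t). Um s t)) \<and>
     splitting_process path_inf mp W Up \<and>
     splitting_process path_sup mm W Um"

text \<open>For \<open>s < t\<close> the indices of the limsup satisfy \<open>s\<^sub>n < t\<^sub>n\<close> for all large \<open>n\<close>, so the values of
  \<open>u\<close> outside \<open>s \<le> t\<close> do not matter.\<close>

definition limsup_modification :: "(real \<Rightarrow> real \<Rightarrow> real) \<Rightarrow> real \<Rightarrow> real \<Rightarrow> real" where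
  "limsup_modification u s t =
     (if s < t
      then real_of_ereal (limsup (\<lambda>n::nat. ereal
             (u ((of_int \<lfloor>real n * s\<rfloor> + 1) / real n) ((of_int \<lfloor>real n * t\<rfloor> - 1) / real n))))
      else u s t)"


section \<open>The flow of kernels\<close>

text \<open>Everything in this section is defined path by path: \<open>w\<close> is a path of \<open>W\<close>, and \<open>up\<close>, \<open>um\<close>
  are paths of the modified processes \<open>U\<^sup>+\<close>, \<open>U\<^sup>-\<close>.\<close>

type_synonym kernel = "complex \<Rightarrow> complex measure"

definition circle :: "complex measure" where
  "circle = restrict_space borel (sphere 0 1)"

definition kernel_comp :: "kernel \<Rightarrow> kernel \<Rightarrow> kernel" where
  "kernel_comp K1 K2 = (\<lambda>x. K1 x \<bind> K2)"

definition eps :: "real \<Rightarrow> complex \<Rightarrow> real" where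
  "eps l z = (if Arg2pi z \<in> {0..l} then 1 else - 1)"

definition Wplus :: "(real \<Rightarrow> real) \<Rightarrow> real \<Rightarrow> real \<Rightarrow> real" where
  "Wplus w s t = w t - path_inf w s t"

definition Wminus :: "(real \<Rightarrow> real) \<Rightarrow> real \<Rightarrow> real \<Rightarrow> real" where
  "Wminus w s t = path_sup w s t - w t"

text \<open>Hitting times are extended reals: the infimum of the empty set is infinity.\<close>

definition rho :: "real \<Rightarrow> (real \<Rightarrow> real) \<Rightarrow> real \<Rightarrow> ereal" where
  "rho l w s = Inf (ereal ` {r. s \<le> r \<and> max (Wplus w s r) (Wminus w s r) = l})"

fun rho_iter :: "real \<Rightarrow> (real \<Rightarrow> real) \<Rightarrow> real \<Rightarrow> nat \<Rightarrow> ereal" where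
  "rho_iter l w s 0 = ereal s"
| "rho_iter l w s (Suc k) =
     (if rho_iter l w s k = \<infinity> then \<infinity> else rho l w (real_of_ereal (rho_iter l w s k)))"

definition tau :: "real \<Rightarrow> (real \<Rightarrow> real) \<Rightarrow> real \<Rightarrow> complex \<Rightarrow> ereal" where
  "tau l w s z = Inf (ereal ` {r. s \<le> r \<and> z * cis (eps l z * (w r - w s)) \<in> {1, cis l}})"

text \<open>The measure \<open>p \<delta>\<^sub>x + (1 - p) \<delta>\<^sub>y\<close>.\<close>

definition two_point :: "real \<Rightarrow> complex \<Rightarrow> complex \<Rightarrow> complex measure" where
  "two_point p x y = measure_of (space circle) (sets circle)
     (\<lambda>A. ennreal p * emeasure (return circle x) A + ennreal (1 - p) * emeasure (return circle y) A)"

text \<open>The kernel from \<open>s\<close> to \<open>t\<close> for \<open>s \<le> t \<le> rho l w s\<close>.\<close>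

definition local_kernel ::
  "real \<Rightarrow> (real \<Rightarrow> real \<Rightarrow> real) \<Rightarrow> (real \<Rightarrow> real \<Rightarrow> real) \<Rightarrow> (real \<Rightarrow> real) \<Rightarrow> real \<Rightarrow> real \<Rightarrow> kernel"
where
  "local_kernel l up um w s t z =
     (let K1 = two_point (up s t) (cis (Wplus w s t)) (cis (- Wplus w s t));
          Kl = two_point (um s t) (cis (l + Wminus w s t)) (cis (l - Wminus w s t));
          T = tau l w s z
      in if z = 1 then K1
         else if z = cis l then Kl
         else if ereal t \<le> T then return circle (z * cis (eps l z * (w t - w s)))
         else if z * cis (eps l z * (w (real_of_ereal T) - w s)) = 1 then K1
         else Kl)"

text \<open>The product \<open>K\<^bsub>s,\<rho>\<^esub> K\<^bsub>\<rho>,\<rho>\<^sup>2\<^esub> \<dots> K\<^bsub>\<rho>\<^sup>k,t\<^esub>\<close>, bracketed to the right.\<close>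

fun kernel_product ::
  "real \<Rightarrow> (real \<Rightarrow> real \<Rightarrow> real) \<Rightarrow> (real \<Rightarrow> real \<Rightarrow> real) \<Rightarrow> (real \<Rightarrow> real) \<Rightarrow> nat \<Rightarrow> real \<Rightarrow> real \<Rightarrow> kernel"
where
  "kernel_product l up um w 0 s t = local_kernel l up um w s t"
| "kernel_product l up um w (Suc k) s t =
     (let r = real_of_ereal (rho l w s)
      in kernel_comp (local_kernel l up um w s r) (kernel_product l up um w k r t))"

definition flow_kernel ::
  "real \<Rightarrow> (real \<Rightarrow> real \<Rightarrow> real) \<Rightarrow> (real \<Rightarrow> real \<Rightarrow> real) \<Rightarrow> (real \<Rightarrow> real) \<Rightarrow> real \<Rightarrow> real \<Rightarrow> kernel"
where
  "flow_kernel l up um w s t z = measure_of (space circle) (sets circle)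
     (\<lambda>A. \<Sum>k. indicator {k. rho_iter l w s k \<le> ereal t \<and> ereal t < rho_iter l w s (Suc k)} k
                * emeasure (kernel_product l up um w k s t z) A)"

definition random_flow ::
  "real \<Rightarrow> (real \<Rightarrow> real \<Rightarrow> 'a \<Rightarrow> real) \<Rightarrow> (real \<Rightarrow> real \<Rightarrow> 'a \<Rightarrow> real) \<Rightarrow> (real \<Rightarrow> 'a \<Rightarrow> real)
   \<Rightarrow> 'a \<Rightarrow> real \<Rightarrow> real \<Rightarrow> kernel" where
  "random_flow l Up Um W \<omega> =
     flow_kernel l (limsup_modification (\<lambda>s t. Up s t \<omega>)) (limsup_modification (\<lambda>s t. Um s t \<omega>))
       (\<lambda>t. W t \<omega>)"

end

theory Submission
  imports Defs
begin

text \<open>Let \<open>\<sigma> = 1\<close> for the target \<open>e\<^sup>i\<^sup>l\<close> and \<open>\<sigma> = - 1\<close> for the target \<open>1\<close>. Suppose that during a step of the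
  chain \<open>\<rho>\<^sup>n\<close> the path \<open>\<sigma> W\<close> rises by at least \<open>l / 2\<close>. Then the step ends when \<open>\<sigma> W\<close> is \<open>l\<close> above its
  running infimum and at its running supremum. Hence every particle on the short arc and every
  particle that splits ends at the target or at distance \<open>l\<close> from the other endpoint on the long
  arc, and every particle of the long arc comes closer to the target by at least \<open>l / 2\<close>. After \<open>N\<close>
  such steps in a row, with \<open>N l / 2 \<ge> 2 \<pi>\<close>, all the mass sits at the target, whatever the values
  of \<open>U\<^sup>+, U\<^sup>- \<in> [0, 1]\<close> and whatever happened before.

  Such runs of steps occur whenever \<open>\<sigma> W\<close> rises by \<open>(N + 1) l\<close> on a time interval on which it never
  falls by more than \<open>l / 2\<close>. By the independence of the increments of \<open>W\<close> over disjoint intervals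
  and the zero-one law, this happens almost surely on infinitely many intervals.\<close>

section \<open>Oscillations of the driving path\<close>

text \<open>Why \<open>l / 2\<close>: a step that ends with \<open>\<sigma> W\<close> exactly
  \<open>l\<close> above its minimum and at least \<open>l / 2\<close> above its starting value
  falls at most \<open>l / 2\<close> below that value on the way. So only a particle within
  \<open>l / 2\<close> of the endpoint opposite to the target can be driven into that endpoint, and
  being put at distance \<open>l\<close> from it is again a gain of at least \<open>l / 2\<close>.
  Conversely, if no fall exceeds \<open>l / 2\<close>, a step that ends by a rise of
  \<open>l\<close> from its minimum has a net gain of at least \<open>l / 2\<close>. The good steps
  must be consecutive because other steps can push particles of the long arc back. The filtration is
  not completed, so the times are defined and shown to be adapted for every sample point; only their
  finiteness, their divergence and the law at these times are almost sure. To make hitting times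
  adapted, \<open>rho\<close> is expressed through \<open>oscillates\<close>. This condition leaves
  the order of \<open>u\<close> and \<open>v\<close> open, so it covers rises and falls alike, and
  it involves only increments inside \<open>{s..t}\<close>.\<close>

definition oscillates :: "real \<Rightarrow> (real \<Rightarrow> real) \<Rightarrow> real \<Rightarrow> real \<Rightarrow> bool" where
  "oscillates l w s t \<longleftrightarrow> (\<exists>u\<in>{s..t}. \<exists>v\<in>{s..t}. l \<le> w v - w u)"

lemma oscillates_mono: "oscillates l w s t \<Longrightarrow> s' \<le> s \<Longrightarrow> t \<le> t' \<Longrightarrow> oscillates l w s' t'"
  unfolding oscillates_def by (meson atLeastAtMost_iff order_trans)

lemma path_inf_eqI: "u \<in> {s..t} \<Longrightarrow> (\<And>q. q \<in> {s..t} \<Longrightarrow> w u \<le> w q) \<Longrightarrow> path_inf w s t = w u"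
  unfolding path_inf_def by (rule cInf_eq_minimum) auto

lemma path_sup_eqI: "u \<in> {s..t} \<Longrightarrow> (\<And>q. q \<in> {s..t} \<Longrightarrow> w q \<le> w u) \<Longrightarrow> path_sup w s t = w u"
  unfolding path_sup_def by (rule cSup_eq_maximum) auto

lemma path_inf_attained:
  assumes "continuous_on {s..t} w" "s \<le> t"
  obtains u where "u \<in> {s..t}" "path_inf w s t = w u" "\<And>q. q \<in> {s..t} \<Longrightarrow> w u \<le> w q"
proof -
  obtain u where "u \<in> {s..t}" "\<And>q. q \<in> {s..t} \<Longrightarrow> w u \<le> w q"
    using continuous_attains_inf[of "{s..t}" w] assms by auto
  then show ?thesis using path_inf_eqI that by metis
qed

lemma path_sup_attained:
  assumes "continuous_on {s..t} w" "s \<le> t"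
  obtains u where "u \<in> {s..t}" "path_sup w s t = w u" "\<And>q. q \<in> {s..t} \<Longrightarrow> w q \<le> w u"
proof -
  obtain u where "u \<in> {s..t}" "\<And>q. q \<in> {s..t} \<Longrightarrow> w q \<le> w u"
    using continuous_attains_sup[of "{s..t}" w] assms by auto
  then show ?thesis using path_sup_eqI that by metis
qed

text \<open>The extrema of a continuous path on a compact interval are attained, so
  \<open>Wplus\<close> and \<open>Wminus\<close> are the largest values of \<open>w r - w u\<close>
  and \<open>w u - w r\<close>.\<close>

lemma excursion_less_iff:
  assumes "continuous_on {s..r} w" "s \<le> r"
  shows "max (Wplus w s r) (Wminus w s r) < l \<longleftrightarrow> (\<forall>u\<in>{s..r}. \<bar>w r - w u\<bar> < l)"
proof -
  obtain u where u: "u \<in> {s..r}" "path_inf w s r = w u" "\<And>q. q \<in> {s..r} \<Longrightarrow> w u \<le> w q"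
    using path_inf_attained[OF assms] by blast
  obtain v where v: "v \<in> {s..r}" "path_sup w s r = w v" "\<And>q. q \<in> {s..r} \<Longrightarrow> w q \<le> w v"
    using path_sup_attained[OF assms] by blast
  show ?thesis
  proof
    assume a: "max (Wplus w s r) (Wminus w s r) < l"
    show "\<forall>u\<in>{s..r}. \<bar>w r - w u\<bar> < l"
    proof
      fix q assume "q \<in> {s..r}"
      then show "\<bar>w r - w q\<bar> < l"
        using a u(3)[of q] v(3)[of q] by (auto simp: Wplus_def Wminus_def u(2) v(2) abs_less_iff)
    qed
  next
    assume a: "\<forall>u\<in>{s..r}. \<bar>w r - w u\<bar> < l"
    show "max (Wplus w s r) (Wminus w s r) < l"
      using a[rule_format, OF u(1)] a[rule_format, OF v(1)]
      by (auto simp: Wplus_def Wminus_def u(2) v(2) abs_less_iff)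
  qed
qed

text \<open>The value \<open>\<sigma> = 1\<close> means that \<open>w\<close> has risen by \<open>l\<close> above its running infimum at the time
  \<open>\<rho>\<close>, and \<open>\<sigma> = - 1\<close> that it has fallen by \<open>l\<close> below its running supremum.\<close>

lemma rho_finite:
  assumes w: "continuous_on {0..} w" and s: "0 \<le> s" and l: "0 < l" and osc: "oscillates l w s t"
  obtains r \<sigma> where "rho l w s = ereal r" "s < r" "r \<le> t" "oscillates l w s r"
    "\<sigma> \<in> {1, -1}" "\<And>q. q \<in> {s..r} \<Longrightarrow> 0 \<le> \<sigma> * (w r - w q)" "\<And>q. q \<in> {s..r} \<Longrightarrow> \<sigma> * (w r - w q) \<le> l"
    "\<exists>u\<in>{s..r}. \<sigma> * (w r - w u) = l"
    "\<And>q q'. q \<in> {s..r} \<Longrightarrow> q' \<in> {s..r} \<Longrightarrow> w q - w q' \<le> l"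
proof -
  have cont: "continuous_on {s..x} w" for x using w by (rule continuous_on_subset) (use s in auto)
  \<comment> \<open>Pairs (earlier time, later time). Minimising the second component over the
    compact set of pairs whose values differ by at least \<open>l\<close> yields the first such time
    \<open>r\<close>.\<close>
  define K where "K = {p :: real \<times> real. p \<in> {s..t} \<times> {s..t} \<and> fst p \<le> snd p}"
  have K: "compact K"
  proof -
    have "K = ({s..t} \<times> {s..t}) \<inter> {p. fst p \<le> snd p}" by (auto simp: K_def)
    moreover have "closed {p :: real \<times> real. fst p \<le> snd p}" by (intro closed_Collect_le continuous_intros)
    ultimately show ?thesis using compact_Times[of "{s..t}" "{s..t}"] by (simp add: compact_Int_closed)
  qed
  define f where "f = (\<lambda>p. \<bar>w (snd p) - w (fst p)\<bar>)"
  have "continuous_on K f"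
    unfolding f_def by (intro continuous_intros continuous_on_compose2[OF cont[of t]]) (auto simp: K_def)
  then have C: "compact (K \<inter> f -` {l..})"
    using K by (metis compact_Int_closed closed_atLeast continuous_closed_preimage compact_imp_closed inf_left_idem)
  have "K \<inter> f -` {l..} \<noteq> {}"
  proof -
    obtain u v where "u \<in> {s..t}" "v \<in> {s..t}" "l \<le> w v - w u" using osc unfolding oscillates_def by blast
    then have "(min u v, max u v) \<in> K \<inter> f -` {l..}" by (auto simp: K_def f_def min_def max_def)
    then show ?thesis by blast
  qed
  then obtain p where p: "p \<in> K \<inter> f -` {l..}" and pmin: "\<And>p'. p' \<in> K \<inter> f -` {l..} \<Longrightarrow> snd p \<le> snd p'"
    using continuous_attains_inf[OF C, of snd] continuous_on_snd[OF continuous_on_id] by blast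
  obtain u r where ur: "p = (u, r)" by fastforce
  have u: "s \<le> u" "u \<le> r" "r \<le> t" "l \<le> \<bar>w r - w u\<bar>" using p ur by (auto simp: K_def f_def)
  with l have ur': "u < r" by (cases "u = r") auto
  have before: "\<bar>w q - w q'\<bar> < l" if "s \<le> q'" "q' \<le> q" "q < r" for q q'
  proof (rule ccontr)
    assume "\<not> ?thesis"
    then have "(q', q) \<in> K \<inter> f -` {l..}" using that u by (auto simp: K_def f_def)
    from pmin[OF this] ur that show False by auto
  qed
  \<comment> \<open>Before \<open>r\<close> all differences are below \<open>l\<close>; the left
    limit extends this to \<open>r\<close> with a weak inequality.\<close>
  have "(w \<longlongrightarrow> w r) (at r within {s..r})" using cont[of r] u unfolding continuous_on by auto
  then have lim: "(w \<longlongrightarrow> w r) (at_left r)"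
    using u ur' by (simp add: at_within_Icc_at_left)
  have bd: "\<bar>w r - w q\<bar> \<le> l" if "s \<le> q" "q < r" for q
  proof (rule tendsto_upperbound)
    show "((\<lambda>x. \<bar>w x - w q\<bar>) \<longlongrightarrow> \<bar>w r - w q\<bar>) (at_left r)" by (intro tendsto_intros lim)
    have "eventually (\<lambda>x. x \<in> {q<..<r}) (at_left r)" using that by (simp add: eventually_at_left_field) blast
    then show "eventually (\<lambda>x. \<bar>w x - w q\<bar> \<le> l) (at_left r)"
      by eventually_elim (rule less_imp_le, rule before, use that in auto)
  qed simp
  have rng: "\<bar>w q - w q'\<bar> \<le> l" if "q \<in> {s..r}" "q' \<in> {s..r}" for q q'
    using that bd[of q] bd[of q'] before[of q q'] before[of q' q] l by (auto simp: abs_minus_commute) force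
  define \<sigma> :: real where "\<sigma> = (if w u \<le> w r then 1 else -1)"
  have eq: "\<sigma> * (w r - w u) = l"
    using u rng[of r u] by (auto simp: \<sigma>_def abs_if split: if_splits)
  \<comment> \<open>The values at \<open>u\<close> and \<open>r\<close> are already \<open>l\<close>
    apart, the largest possible range, so they are the two extrema.\<close>
  have pos: "0 \<le> \<sigma> * (w r - w q)" if "q \<in> {s..r}" for q
    using rng[of q u] rng[of r u] that u eq by (auto simp: \<sigma>_def abs_if split: if_splits)
  have le: "\<sigma> * (w r - w q) \<le> l" if "q \<in> {s..r}" for q
    using rng[of r q] that u by (auto simp: \<sigma>_def)
  have "max (Wplus w s r) (Wminus w s r) = l"
  proof (cases "\<sigma> = 1")
    case True
    have "path_inf w s r = w u"
    proof (rule path_inf_eqI)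
      fix q assume "q \<in> {s..r}" then show "w u \<le> w q" using le[of q] eq True by simp
    qed (use u in auto)
    moreover have "path_sup w s r = w r"
    proof (rule path_sup_eqI)
      fix q assume "q \<in> {s..r}" then show "w q \<le> w r" using pos[of q] True by simp
    qed (use u in auto)
    ultimately show ?thesis using eq True l by (simp add: Wplus_def Wminus_def)
  next
    case False
    then have m: "\<sigma> = -1" by (auto simp: \<sigma>_def split: if_splits)
    have "path_sup w s r = w u"
    proof (rule path_sup_eqI)
      fix q assume "q \<in> {s..r}" then show "w q \<le> w u" using le[of q] eq m by simp
    qed (use u in auto)
    moreover have "path_inf w s r = w r"
    proof (rule path_inf_eqI)
      fix q assume "q \<in> {s..r}" then show "w r \<le> w q" using pos[of q] m by simp
    qed (use u in auto)
    ultimately show ?thesis using eq m l by (simp add: Wplus_def Wminus_def)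
  qed
  moreover have "r \<le> r'" if "s \<le> r'" "max (Wplus w s r') (Wminus w s r') = l" for r'
  proof (rule ccontr)
    assume "\<not> r \<le> r'"
    then have "\<forall>q\<in>{s..r'}. \<bar>w r' - w q\<bar> < l" using before by auto
    then show False using excursion_less_iff[OF cont \<open>s \<le> r'\<close>, of l] that by simp
  qed
  ultimately have "rho l w s = ereal r"
    unfolding rho_def by (intro Inf_eqI) (use u in auto)
  moreover have "oscillates l w s r"
  proof -
    have "w r - w u = l \<or> w u - w r = l" using eq by (auto simp: \<sigma>_def split: if_splits)
    then show ?thesis unfolding oscillates_def using u by (metis atLeastAtMost_iff order_refl order_trans)
  qed
  moreover have "\<sigma> \<in> {1, -1}" by (simp add: \<sigma>_def)
  moreover have "\<exists>u\<in>{s..r}. \<sigma> * (w r - w u) = l" using eq u by auto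
  moreover have "w q - w q' \<le> l" if "q \<in> {s..r}" "q' \<in> {s..r}" for q q'
    using rng[OF that] by simp
  moreover have "s < r" using u ur' by simp
  ultimately show ?thesis using that[of r \<sigma>] u(3) pos le by blast
qed

text \<open>This serves twice: it makes the chain adapted, and it shows that a step ends inside any
  interval where the path still has a rise of \<open>l\<close> left.\<close>

lemma rho_le_iff:
  assumes w: "continuous_on {0..} w" and s: "0 \<le> s" and l: "0 < l"
  shows "rho l w s \<le> ereal t \<longleftrightarrow> oscillates l w s t"
proof
  assume "rho l w s \<le> ereal t"
  then have "rho l w s < \<infinity>" using le_less_trans by force
  then obtain r where r: "s \<le> r" "max (Wplus w s r) (Wminus w s r) = l"
    unfolding rho_def Inf_less_iff by auto
  have "continuous_on {s..r} w" using w by (rule continuous_on_subset) (use s in auto)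
  from excursion_less_iff[OF this r(1), of l] r
  obtain u where u: "u \<in> {s..r}" "l \<le> \<bar>w r - w u\<bar>" by (auto simp: not_less)
  then have "l \<le> w r - w u \<or> l \<le> w u - w r" by linarith
  then have "oscillates l w s r" unfolding oscillates_def using u r(1)
    by (meson atLeastAtMost_iff order_refl)
  \<comment> \<open>The time \<open>r\<close> is only some element of the hitting set and may exceed
    \<open>t\<close>. It provides an oscillation, from which \<open>rho_finite\<close> identifies
    the infimum as an attained time \<open>r'\<close>.\<close>
  with w s l obtain r' where "rho l w s = ereal r'" "oscillates l w s r'" by (rule rho_finite)
  with \<open>rho l w s \<le> ereal t\<close> show "oscillates l w s t" by (auto intro: oscillates_mono)
next
  assume "oscillates l w s t"
  with w s l obtain r where "rho l w s = ereal r" "r \<le> t" by (rule rho_finite)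
  then show "rho l w s \<le> ereal t" by simp
qed

lemma rho_ge: "ereal s \<le> rho l w s"
  unfolding rho_def by (rule Inf_greatest) auto

lemma rho_iter_ge: "ereal s \<le> rho_iter l w s n"
proof (induction n)
  case (Suc n)
  show ?case
  proof (cases "rho_iter l w s n")
    case (real r)
    then show ?thesis using Suc rho_ge[of r l w] by simp (meson order_trans ereal_less_eq(3))
  qed (use Suc in auto)
qed simp

lemma rho_iter_le_Suc: "rho_iter l w s n \<le> rho_iter l w s (Suc n)"
  using rho_iter_ge[of s l w n] rho_ge[of _ l w] by (cases "rho_iter l w s n") auto

lemma rho_iter_mono: "m \<le> n \<Longrightarrow> rho_iter l w s m \<le> rho_iter l w s n"
  by (rule lift_Suc_mono_le[of "rho_iter l w s"]) (rule rho_iter_le_Suc)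

section \<open>The chain of times along a path that oscillates by \<open>l\<close> again and
  again\<close>

locale oscillating_path =
  fixes l :: real and w :: "real \<Rightarrow> real"
  assumes l: "0 < l" and w: "continuous_on {0..} w"
    and osc: "\<And>s. 0 \<le> s \<Longrightarrow> \<exists>t. oscillates l w s t"
begin

definition rt :: "nat \<Rightarrow> real" where "rt n = real_of_ereal (rho_iter l w 0 n)"

lemma rt_0 [simp]: "rt 0 = 0" by (simp add: rt_def)

lemma rho_iter_rt: "rho_iter l w 0 n = ereal (rt n)"
proof (induction n)
  case (Suc n)
  then have "0 \<le> rt n" using rho_iter_ge[of 0 l w n] by (simp add: zero_ereal_def)
  with osc obtain t where "oscillates l w (rt n) t" by blast
  with w \<open>0 \<le> rt n\<close> l obtain r where "rho l w (rt n) = ereal r" by (rule rho_finite)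
  then have "rho_iter l w 0 (Suc n) = ereal r" by (simp add: Suc)
  then show ?case by (simp add: rt_def del: rho_iter.simps)
qed (simp add: zero_ereal_def)

lemma rt_nonneg: "0 \<le> rt n"
  using rho_iter_ge[of 0 l w n] by (simp add: rho_iter_rt zero_ereal_def)

lemma rho_rt: "rho l w (rt n) = ereal (rt (Suc n))"
  using rho_iter_rt[of "Suc n"] rho_iter_rt[of n] by simp

lemma rt_step:
  obtains \<sigma> where "rt n < rt (Suc n)" "oscillates l w (rt n) (rt (Suc n))"
    "\<sigma> \<in> {1, -1}" "\<And>q. q \<in> {rt n..rt (Suc n)} \<Longrightarrow> 0 \<le> \<sigma> * (w (rt (Suc n)) - w q)"
    "\<And>q. q \<in> {rt n..rt (Suc n)} \<Longrightarrow> \<sigma> * (w (rt (Suc n)) - w q) \<le> l"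
    "\<exists>u\<in>{rt n..rt (Suc n)}. \<sigma> * (w (rt (Suc n)) - w u) = l"
    "\<And>q q'. q \<in> {rt n..rt (Suc n)} \<Longrightarrow> q' \<in> {rt n..rt (Suc n)} \<Longrightarrow> w q - w q' \<le> l"
proof -
  obtain t where "oscillates l w (rt n) t" using osc rt_nonneg by blast
  with w rt_nonneg l show thesis
  proof (rule rho_finite)
    fix r \<sigma>
    assume r: "rho l w (rt n) = ereal r"
    then have "r = rt (Suc n)" by (simp add: rho_rt)
    moreover assume "rt n < r" "oscillates l w (rt n) r" "\<sigma> \<in> {1, -1}"
      "\<And>q. q \<in> {rt n..r} \<Longrightarrow> 0 \<le> \<sigma> * (w r - w q)" "\<And>q. q \<in> {rt n..r} \<Longrightarrow> \<sigma> * (w r - w q) \<le> l"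
      "\<exists>u\<in>{rt n..r}. \<sigma> * (w r - w u) = l"
      "\<And>q q'. q \<in> {rt n..r} \<Longrightarrow> q' \<in> {rt n..r} \<Longrightarrow> w q - w q' \<le> l"
    ultimately show thesis using that[of \<sigma>] by blast
  qed
qed

lemma rt_less_Suc: "rt n < rt (Suc n)"
  using rt_step[of n] by blast

lemma rt_mono: "m \<le> n \<Longrightarrow> rt m \<le> rt n"
  by (rule lift_Suc_mono_le[of rt]) (simp add: rt_less_Suc less_imp_le)

lemma rt_strict_mono: "m < n \<Longrightarrow> rt m < rt n"
  by (rule lift_Suc_mono_less[of rt]) (rule rt_less_Suc)

text \<open>A finite limit of the chain is impossible: near it continuity keeps the variation of
  \<open>w\<close> below \<open>l\<close>, while every step contains an oscillation of size
  \<open>l\<close>.\<close>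

lemma rt_at_top: "filterlim rt at_top sequentially"
proof (rule ccontr)
  assume "\<not> ?thesis"
  then obtain Z where "\<not> (\<exists>N. \<forall>n\<ge>N. Z \<le> rt n)"
    by (auto simp: filterlim_at_top eventually_sequentially)
  then have "\<forall>n. rt n \<le> Z" by (metis linear order_trans rt_mono)
  then obtain x where lim: "rt \<longlonglongrightarrow> x" and le: "\<And>n. rt n \<le> x"
    using incseq_convergent[of rt Z] rt_mono by (auto simp: incseq_def)
  have "0 \<le> x" using le[of 0] by simp
  then have "(w \<longlongrightarrow> w x) (at x within {0..})" using w by (simp add: continuous_on)
  then have "eventually (\<lambda>y. dist (w y) (w x) < l / 2) (at x within {0..})"
    using tendstoD[of w "w x" _ "l / 2"] l by simp
  then obtain d where d: "d > 0" "\<And>y. y \<in> {0..} \<Longrightarrow> y \<noteq> x \<Longrightarrow> dist y x < d \<Longrightarrow> dist (w y) (w x) < l/2"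
    unfolding eventually_at by blast
  have d': "\<bar>w y - w x\<bar> < l/2" if "0 \<le> y" "\<bar>y - x\<bar> < d" for y
    using d(2)[of y] that l by (cases "y = x") (auto simp: dist_real_def)
  from lim d(1) obtain n where n: "\<bar>rt n - x\<bar> < d" by (force simp: lim_sequentially dist_real_def)
  obtain u v where uv: "u \<in> {rt n..rt (Suc n)}" "v \<in> {rt n..rt (Suc n)}" "l \<le> w v - w u"
    using rt_step[of n] unfolding oscillates_def by metis
  have "\<bar>w u - w x\<bar> < l/2" "\<bar>w v - w x\<bar> < l/2"
    using uv n le[of "Suc n"] rt_nonneg[of n] by (intro d'; simp)+
  then show False using uv(3) by linarith
qed

text \<open>A rise by at least \<open>(N + 1) l\<close> on an interval on which all falls are small: the part of the
  rise before the first \<open>\<rho>\<close> in the interval is at most \<open>l\<close>, and every further step of the chain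
  uses at most \<open>l\<close> of it.\<close>

lemma steady_rise_steps:
  assumes ab: "0 \<le> a" "a \<le> b" and \<sigma>: "\<sigma> \<in> {1, -1}"
    and steady: "\<And>u v. a \<le> u \<Longrightarrow> u \<le> v \<Longrightarrow> v \<le> b \<Longrightarrow> - (l/2) \<le> \<sigma> * (w v - w u)"
    and rise: "real (Suc N) * l \<le> \<sigma> * (w b - w a)"
  obtains n where "a \<le> rt n" "\<And>i. i \<in> {n..<n + N} \<Longrightarrow> l/2 \<le> \<sigma> * (w (rt (Suc i)) - w (rt i))"
proof (cases "N = 0")
  case True
  obtain n where "a \<le> rt n"
    using rt_at_top by (auto simp: filterlim_at_top eventually_sequentially)
  with True that show ?thesis by auto
next
  case False
  \<comment> \<open>With \<open>N > 0\<close> the total rise exceeds what the step straddling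
    \<open>a\<close> can contain, which forces that step to end before \<open>b\<close>.\<close>
  then have "2 * l \<le> real (Suc N) * l" using l by (intro mult_right_mono) auto
  then have rise2: "2 * l \<le> \<sigma> * (w b - w a)" using rise by linarith
  define n where "n = (LEAST n. a \<le> rt n)"
  obtain m where "a \<le> rt m"
    using rt_at_top by (auto simp: filterlim_at_top eventually_sequentially)
  then have n: "a \<le> rt n" and least: "\<And>m. m < n \<Longrightarrow> rt m < a"
    unfolding n_def by (auto intro: LeastI dest: not_less_Least simp: not_le)
  have start: "rt n \<le> b \<and> \<sigma> * (w (rt n) - w a) \<le> l"
  proof (cases n)
    case 0
    then have "a = 0" using n ab by simp
    then show ?thesis using 0 ab l by simp
  next
    case (Suc m)
    then have m: "rt m < a" using least by simp
    \<comment> \<open>The step from \<open>rt m\<close> to \<open>rt n\<close> contains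
      \<open>a\<close>, and the range of the path over one step is at most \<open>l\<close>.\<close>
    have rng: "\<sigma> * (w q - w a) \<le> l" if "q \<in> {a..rt n}" for q
    proof -
      have "w q - w a \<le> l" "w a - w q \<le> l"
        using rt_step[of m] that m n unfolding Suc by (smt (verit) atLeastAtMost_iff)+
      then show ?thesis using \<sigma> by auto
    qed
    have "rt n \<le> b"
    proof (rule ccontr)
      assume "\<not> ?thesis"
      then have "\<sigma> * (w b - w a) \<le> l" using ab by (intro rng) auto
      then show False using rise2 l by linarith
    qed
    then show ?thesis using rng[of "rt n"] n by simp
  qed
  have step: "rt (n + j) \<le> b \<and> \<sigma> * (w (rt (n + j)) - w a) \<le> real (Suc j) * l \<and>
      (\<forall>i\<in>{n..<n + j}. l/2 \<le> \<sigma> * (w (rt (Suc i)) - w (rt i)))" if "j \<le> N" for j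
    using that
  proof (induction j)
    case (Suc j)
    define s where "s = rt (n + j)"
    have IH: "s \<le> b" "\<sigma> * (w s - w a) \<le> real (Suc j) * l"
      "\<forall>i\<in>{n..<n + j}. l/2 \<le> \<sigma> * (w (rt (Suc i)) - w (rt i))"
      using Suc by (auto simp: s_def)
    have as: "a \<le> s" using n rt_mono[of n "n + j"] by (simp add: s_def)
    have "real (Suc (Suc j)) * l \<le> real (Suc N) * l" using l Suc.prems by (intro mult_right_mono) auto
    \<comment> \<open>The initial piece and \<open>j\<close> steps have used at most
      \<open>(j + 1) * l\<close> of the rise; since \<open>j < N\<close>, at least \<open>l\<close>
      remains and the next step ends by \<open>b\<close>.\<close>
    then have "l \<le> \<sigma> * (w b - w s)" using rise IH(2) by (auto simp: algebra_simps)
    then have "oscillates l w s b"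
      using \<sigma> IH(1) unfolding oscillates_def by (metis atLeastAtMost_iff empty_iff insert_iff minus_diff_eq mult_1 mult_minus1 order_refl)
    then have r: "rt (Suc (n + j)) \<le> b"
      using rho_le_iff[OF w rt_nonneg l, of "n + j" b] rho_rt[of "n + j"] by (simp add: s_def)
    define r where "r = rt (Suc (n + j))"
    obtain \<sigma>' where s': "s < r" "\<sigma>' \<in> {1, -1}"
      "\<And>q. q \<in> {s..r} \<Longrightarrow> \<sigma>' * (w r - w q) \<le> l" "\<exists>u\<in>{s..r}. \<sigma>' * (w r - w u) = l"
      using rt_step[of "n + j"] unfolding s_def r_def by metis
    then obtain u where u: "u \<in> {s..r}" "\<sigma>' * (w r - w u) = l" by blast
    have 1: "- (l/2) \<le> \<sigma> * (w r - w u)" using u as r by (intro steady) (auto simp: r_def)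
    \<comment> \<open>A step ending in the opposite direction would contain a fall of
      \<open>l\<close>, more than the allowed \<open>l / 2\<close>.\<close>
    have "\<sigma>' = \<sigma>"
    proof (rule ccontr)
      assume "\<sigma>' \<noteq> \<sigma>"
      then have "\<sigma>' = - \<sigma>" using \<sigma> s'(2) by auto
      then show False using 1 u(2) l by simp
    qed
    \<comment> \<open>The net gain is the rise \<open>l\<close> from \<open>u\<close> to
      \<open>r\<close> minus a fall of at most \<open>l / 2\<close> from \<open>s\<close> to
      \<open>u\<close>.\<close>
    moreover have "- (l/2) \<le> \<sigma> * (w u - w s)" using u as r by (intro steady) (auto simp: r_def)
    ultimately have "l/2 \<le> \<sigma> * (w r - w s)" "\<sigma> * (w r - w s) \<le> l"
      using u s'(1) s'(3)[of s] by (auto simp: algebra_simps)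
    then show ?case using r IH(2,3)
      by (auto simp: r_def s_def less_Suc_eq algebra_simps)
  qed (use start in auto)
  from step[of N] n show ?thesis by (intro that[of n]) auto
qed

end

section \<open>Kernels on the circle\<close>

lemma Arg2pi_cis: "0 \<le> a \<Longrightarrow> a < 2 * pi \<Longrightarrow> Arg2pi (cis a) = a"
  by (rule Arg2pi_unique[of 1]) (auto simp: cis_conv_exp)

lemma cis_Arg2pi: "norm z = 1 \<Longrightarrow> cis (Arg2pi z) = z"
  using Arg2pi_eq[of z] by (simp add: cis_conv_exp)

text \<open>The discontinuities lie on the nonnegative real axis, where the function vanishes, so
  cutting it off there changes nothing.\<close>

lemma borel_measurable_Arg2pi [measurable]: "Arg2pi \<in> borel_measurable borel"
proof -
  have "continuous_on (- \<real>\<^sub>\<ge>\<^sub>0) Arg2pi"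
    by (intro continuous_at_imp_continuous_on ballI continuous_at_Arg2pi) auto
  then have "(\<lambda>z. indicator (- \<real>\<^sub>\<ge>\<^sub>0) z *\<^sub>R Arg2pi z) \<in> borel_measurable borel"
    by (intro borel_measurable_continuous_on_indicator) auto
  moreover have "(\<lambda>z. indicator (- \<real>\<^sub>\<ge>\<^sub>0) z *\<^sub>R Arg2pi z) = Arg2pi"
    by (auto simp: indicator_def fun_eq_iff Arg2pi_eq_0 complex_nonneg_Reals_iff complex_is_Real_iff)
  ultimately show ?thesis by simp
qed

lemma space_circle [simp]: "space circle = sphere 0 1"
  by (simp add: circle_def space_restrict_space)

lemma finite_sets_circle: "finite A \<Longrightarrow> A \<subseteq> sphere 0 1 \<Longrightarrow> A \<in> sets circle"
  unfolding circle_def by (subst sets_restrict_space_iff) (auto intro: finite_imp_closed borel_closed)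

lemma AE_return_circle: "x \<in> sphere 0 1 \<Longrightarrow> P x \<Longrightarrow> AE y in return circle x. P y"
proof -
  assume x: "x \<in> sphere 0 1" "P x"
  have "AE y in return circle x. y \<in> {x}"
    by (subst AE_return) (use x in \<open>auto simp: pred_def intro!: finite_sets_circle\<close>)
  then show "AE y in return circle x. P y" by eventually_elim (use x in simp)
qed

text \<open>As the image of a biased coin, \<open>two_point\<close> is visibly a probability
  measure, and almost sure statements reduce to its two atoms.\<close>

lemma two_point_distr:
  assumes p: "p \<in> {0..1}" and xy: "x \<in> sphere 0 1" "y \<in> sphere 0 1"
  shows "two_point p x y = distr (measure_pmf (bernoulli_pmf p)) circle (\<lambda>b. if b then x else y)"
    (is "_ = ?D")
proof -
  have "emeasure ?D A =
      ennreal p * emeasure (return circle x) A + ennreal (1 - p) * emeasure (return circle y) A"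
    if "A \<in> sets circle" for A
  proof -
    have "emeasure ?D A = (\<integral>\<^sup>+b. indicator A (if b then x else y) \<partial>measure_pmf (bernoulli_pmf p))"
      using that xy by (subst emeasure_distr) (auto simp flip: nn_integral_indicator intro!: nn_integral_cong simp: indicator_def)
    then show ?thesis using that p xy by (simp add: mult.commute)
  qed
  then have "two_point p x y = measure_of (space circle) (sets circle) (emeasure ?D)"
    unfolding two_point_def
    by (intro measure_of_eq sets.space_closed) (simp only: sets.sigma_sets_eq)
  also have "\<dots> = ?D" using measure_of_of_measure[of ?D] by simp
  finally show ?thesis .
qed

lemma two_point_prob:
  assumes "p \<in> {0..1}" "x \<in> sphere 0 1" "y \<in> sphere 0 1"
  shows "two_point p x y \<in> space (prob_algebra circle)"
  unfolding two_point_distr[OF assms] space_prob_algebra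
  using assms(2,3) by (auto intro!: measure_pmf.prob_space_distr)

lemma AE_two_point:
  assumes "p \<in> {0..1}" "x \<in> sphere 0 1" "y \<in> sphere 0 1" "P x" "P y"
  shows "AE z in two_point p x y. P z"
proof -
  have "AE z in two_point p x y. z \<in> {x, y}"
    unfolding two_point_distr[OF assms(1-3)]
  proof (subst AE_distr_iff)
    have "{z \<in> space circle. z \<in> {x, y}} = {x, y}" using assms(2,3) by auto
    then show "{z \<in> space circle. z \<in> {x, y}} \<in> sets circle"
      using finite_sets_circle[of "{x, y}"] assms(2,3) by simp
  qed (use assms(2,3) in auto)
  then show ?thesis by eventually_elim (use assms in auto)
qed

lemma two_point_same:
  assumes "p \<in> {0..1}" "x \<in> sphere 0 1"
  shows "two_point p x x = return circle x"
  unfolding two_point_distr[OF assms assms(2)] using assms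
  by (simp add: measure_pmf.distr_const)

text \<open>Integrating a constant against a probability measure returns the constant. By this step
  a Dirac law of the last factors passes to the whole right-bracketed product.\<close>

lemma bind_AE_const:
  assumes K: "K \<in> space (prob_algebra N)" and f: "f \<in> N \<rightarrow>\<^sub>M prob_algebra R"
    and ae: "AE x in K. f x = \<mu>" and sets: "sets \<mu> = sets R"
  shows "K \<bind> f = \<mu>"
proof -
  interpret prob_space K using K by (simp add: space_prob_algebra)
  have K': "sets K = sets N" using K by (simp add: space_prob_algebra)
  have f': "f \<in> K \<rightarrow>\<^sub>M subprob_algebra R"
    using measurable_prob_algebraD[OF f] measurable_cong_sets[OF K' refl] by blast
  show ?thesis
  proof (rule measure_eqI)
    show "sets (K \<bind> f) = sets \<mu>"
      using sets_bind[OF sets_kernel[OF f'] not_empty] sets by simp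
    fix X assume "X \<in> sets (K \<bind> f)"
    then have X: "X \<in> sets R" using sets_bind[OF sets_kernel[OF f'] not_empty] by simp
    have "emeasure (K \<bind> f) X = (\<integral>\<^sup>+x. emeasure (f x) X \<partial>K)"
      using not_empty f' X by (rule emeasure_bind)
    also have "\<dots> = (\<integral>\<^sup>+x. emeasure \<mu> X \<partial>K)"
      by (rule nn_integral_cong_AE) (use ae in eventually_elim, auto)
    finally show "emeasure (K \<bind> f) X = emeasure \<mu> X" by (simp add: emeasure_space_1)
  qed
qed

text \<open>The point \<open>cis (\<sigma> * a)\<close> with \<open>0 < a < arc_len l \<sigma>\<close> runs through the open arc on which
  \<open>eps l\<close> is \<open>\<sigma>\<close>; here \<open>a\<close> is the distance from \<open>1\<close> along the arc. In this coordinate the motion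
  is the translation by the increments of \<open>w\<close> on both arcs.\<close>

definition arc_len :: "real \<Rightarrow> real \<Rightarrow> real" where
  "arc_len l \<sigma> = (if \<sigma> = 1 then l else 2 * pi - l)"

text \<open>First alternative: the endpoints of the arc are not reached before time \<open>t\<close>. Second
  alternative: the point \<open>1\<close> is reached before \<open>cis l\<close>.\<close>

definition arc_kernel ::
  "real \<Rightarrow> (real \<Rightarrow> real \<Rightarrow> real) \<Rightarrow> (real \<Rightarrow> real \<Rightarrow> real) \<Rightarrow> (real \<Rightarrow> real) \<Rightarrow> real \<Rightarrow> real
   \<Rightarrow> real \<Rightarrow> real \<Rightarrow> complex measure" where
  "arc_kernel l up um w s t \<sigma> a =
    (if \<forall>r\<in>{s..<t}. 0 < a + (w r - w s) \<and> a + (w r - w s) < arc_len l \<sigma>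
     then return circle (cis (\<sigma> * (a + (w t - w s))))
     else if \<exists>r\<in>{s..<t}. a + (w r - w s) \<le> 0 \<and> (\<forall>q\<in>{s..r}. a + (w q - w s) < arc_len l \<sigma>)
     then two_point (up s t) (cis (Wplus w s t)) (cis (- Wplus w s t))
     else two_point (um s t) (cis (l + Wminus w s t)) (cis (l - Wminus w s t)))"

section \<open>Motion in arc coordinates\<close>

locale kernel_path =
  fixes l :: real and w :: "real \<Rightarrow> real" and up um :: "real \<Rightarrow> real \<Rightarrow> real"
  assumes l: "0 < l" and l_pi: "l \<le> pi" and w: "continuous_on {0..} w"
    and up: "\<And>s t. s \<le> t \<Longrightarrow> up s t \<in> {0..1}" and um: "\<And>s t. s \<le> t \<Longrightarrow> um s t \<in> {0..1}"
begin

lemma Arg2pi_arc: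
  assumes "\<sigma> \<in> {1, -1}" "0 < a" "a < arc_len l \<sigma>"
  shows "Arg2pi (cis (\<sigma> * a)) = (if \<sigma> = 1 then a else 2 * pi - a)"
proof (cases "\<sigma> = 1")
  case True
  then show ?thesis using assms l_pi by (simp add: arc_len_def Arg2pi_cis)
next
  case False
  then have "cis (\<sigma> * a) = cis (2 * pi - a)" using assms by (simp flip: cis_divide add: cis_cnj divide_inverse)
  then show ?thesis using False assms l l_pi by (simp add: arc_len_def Arg2pi_cis)
qed

lemma eps_arc:
  assumes "\<sigma> \<in> {1, -1}" "0 < a" "a < arc_len l \<sigma>"
  shows "eps l (cis (\<sigma> * a)) = \<sigma>"
  using assms unfolding eps_def Arg2pi_arc[OF assms] by (auto simp: arc_len_def)

lemma arc_interior_not_endpoint: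
  assumes "\<sigma> \<in> {1, -1}" "0 < a" "a < arc_len l \<sigma>"
  shows "cis (\<sigma> * a) \<noteq> 1" "cis (\<sigma> * a) \<noteq> cis l"
proof -
  have "Arg2pi (cis (\<sigma> * a)) \<noteq> 0" "Arg2pi (cis (\<sigma> * a)) \<noteq> l"
    unfolding Arg2pi_arc[OF assms] using assms l l_pi by (auto simp: arc_len_def split: if_splits)
  moreover have "Arg2pi 1 = 0" "Arg2pi (cis l) = l"
    using l l_pi Arg2pi_cis[of 0] Arg2pi_cis[of l] by auto
  ultimately show "cis (\<sigma> * a) \<noteq> 1" "cis (\<sigma> * a) \<noteq> cis l" by metis+
qed

lemma cis_l_neq_1: "cis l \<noteq> 1"
  using l l_pi Arg2pi_cis[of l] Arg2pi_cis[of 0] by force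

lemma cis_neg_complement: "cis (- (2 * pi - a)) = cis a"
  using cis_mult[of "- (2 * pi)" a] by (simp flip: cis_inverse)

lemma cis_arc_len: "\<sigma> \<in> {1, -1} \<Longrightarrow> cis (\<sigma> * arc_len l \<sigma>) = cis l"
  using cis_neg_complement[of l] by (auto simp: arc_len_def)

lemma circle_cases:
  assumes "z \<in> sphere 0 1"
  obtains "z = 1" | "z = cis l" | \<sigma> a where "\<sigma> \<in> {1, -1}" "0 < a" "a < arc_len l \<sigma>" "z = cis (\<sigma> * a)"
proof -
  have z: "cis (Arg2pi z) = z" using assms by (intro cis_Arg2pi) auto
  have b: "0 \<le> Arg2pi z" "Arg2pi z < 2 * pi" using Arg2pi_ge_0 Arg2pi_lt_2pi by auto
  consider "Arg2pi z = 0" | "Arg2pi z = l" | "0 < Arg2pi z" "Arg2pi z < l" | "l < Arg2pi z"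
    using b l by linarith
  then show thesis
  proof cases
    case 3
    with z show thesis by (intro that(3)[of 1 "Arg2pi z"]) (auto simp: arc_len_def)
  next
    case 4
    with z b show thesis
      by (intro that(3)[of "-1" "2 * pi - Arg2pi z"])
        (auto simp: arc_len_def cis_neg_complement[simplified])
  qed (use z that in \<open>metis cis_zero\<close>)+
qed

text \<open>Until the coordinate \<open>f\<close> leaves the open interval, the point stays off the
  endpoints; by continuity \<open>f\<close> leaves exactly at \<open>0\<close> or at the arc length.
  Hence \<open>tau\<close> is the exit time, and conditions on the path replace it.\<close>

lemma local_kernel_arc:
  assumes st: "0 \<le> s" "s \<le> t" and \<sigma>: "\<sigma> \<in> {1, -1}" and a: "0 < a" "a < arc_len l \<sigma>"
  shows "local_kernel l up um w s t (cis (\<sigma> * a)) = arc_kernel l up um w s t \<sigma> a"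
proof -
  define f where "f r = a + (w r - w s)" for r
  let ?\<Lambda> = "arc_len l \<sigma>"
  have cont: "continuous_on {s..x} w" for x using w by (rule continuous_on_subset) (use st in auto)
  have e: "eps l (cis (\<sigma> * a)) = \<sigma>" by (rule eps_arc[OF \<sigma> a])
  have mv: "cis (\<sigma> * a) * cis (eps l (cis (\<sigma> * a)) * (w r - w s)) = cis (\<sigma> * f r)" for r
    unfolding e by (simp add: cis_mult f_def algebra_simps)
  have tau: "tau l w s (cis (\<sigma> * a)) = Inf (ereal ` {r. s \<le> r \<and> cis (\<sigma> * f r) \<in> {1, cis l}})"
    unfolding tau_def mv ..
  have interior: "cis (\<sigma> * f r) \<notin> {1, cis l}" if "0 < f r" "f r < ?\<Lambda>" for r
    using arc_interior_not_endpoint[OF \<sigma> that] by auto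
  have fs: "f s = a" by (simp add: f_def)
  show ?thesis
  proof (cases "\<forall>r\<in>{s..<t}. 0 < f r \<and> f r < ?\<Lambda>")
    case True
    \<comment> \<open>An endpoint may be hit at \<open>t\<close> itself; then \<open>tau\<close>
      equals \<open>t\<close> and \<open>local_kernel\<close> still takes its translation
      branch.\<close>
    have "ereal t \<le> tau l w s (cis (\<sigma> * a))"
      unfolding tau by (rule Inf_greatest) (use True interior in force)
    then show ?thesis
      using arc_interior_not_endpoint[OF \<sigma> a] True mv[of t]
      by (simp add: local_kernel_def Let_def arc_kernel_def f_def)
  next
    case False
    then obtain r0 where r0: "s \<le> r0" "r0 < t" "f r0 \<le> 0 \<or> ?\<Lambda> \<le> f r0" by force
    \<comment> \<open>The exit times up to \<open>r0\<close> form a compact set, so there is a first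
      one.\<close>
    let ?C = "{s..r0} \<inter> f -` ({..0} \<union> {?\<Lambda>..})"
    have cf: "continuous_on {s..r0} f" unfolding f_def by (intro continuous_intros cont)
    then have "closed ?C" by (rule continuous_closed_preimage) auto
    then have C: "compact ?C" using compact_Int_closed[OF compact_Icc, of ?C s r0] by simp
    have "?C \<noteq> {}" using r0 by auto
    from continuous_attains_inf[OF C this continuous_on_id]
    obtain T where T: "T \<in> ?C" "\<And>q. q \<in> ?C \<Longrightarrow> T \<le> q" by blast
    have sT: "s \<le> T" "T \<le> r0" "f T \<le> 0 \<or> ?\<Lambda> \<le> f T" using T(1) by auto
    have before: "0 < f q \<and> f q < ?\<Lambda>" if "s \<le> q" "q < T" for q
      using T(2)[of q] that sT by force
    have "s \<noteq> T" using sT fs a by auto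
    then have sT': "s < T" using sT by simp
    have "(f \<longlongrightarrow> f T) (at T within {s..T})"
      using continuous_on_subset[OF cf, of "{s..T}"] sT by (auto simp: continuous_on)
    then have lim: "(f \<longlongrightarrow> f T) (at_left T)" using sT' by (simp add: at_within_Icc_at_left)
    have ev: "eventually (\<lambda>x. 0 \<le> f x \<and> f x \<le> ?\<Lambda>) (at_left T)"
    proof -
      have "eventually (\<lambda>x. x \<in> {s<..<T}) (at_left T)" using sT' by (simp add: eventually_at_left_field) blast
      then show ?thesis
      proof eventually_elim
        case (elim x)
        then show ?case using before[of x] by auto
      qed
    qed
    have "0 \<le> f T" by (rule tendsto_lowerbound[OF lim]) (use ev in \<open>auto elim: eventually_mono\<close>)
    moreover have "f T \<le> ?\<Lambda>" by (rule tendsto_upperbound[OF lim]) (use ev in \<open>auto elim: eventually_mono\<close>)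
    ultimately have fT: "f T = 0 \<or> f T = ?\<Lambda>" using sT by auto
    \<comment> \<open>Later \<open>f\<close> may leave the arc and wrap around the circle, but only
      the first hit matters.\<close>
    have tauT: "tau l w s (cis (\<sigma> * a)) = ereal T"
      unfolding tau
    proof (rule Inf_eqI)
      fix x assume "x \<in> ereal ` {r. s \<le> r \<and> cis (\<sigma> * f r) \<in> {1, cis l}}"
      then obtain r where r: "x = ereal r" "s \<le> r" "cis (\<sigma> * f r) \<in> {1, cis l}" by auto
      show "ereal T \<le> x" using before[of r] interior[of r] r by force
    next
      fix y assume y: "\<And>i. i \<in> ereal ` {r. s \<le> r \<and> cis (\<sigma> * f r) \<in> {1, cis l}} \<Longrightarrow> y \<le> i"
      have "cis (\<sigma> * f T) \<in> {1, cis l}" using fT cis_arc_len[OF \<sigma>] by auto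
      then show "y \<le> ereal T" using sT by (intro y) auto
    qed
    have hit: "cis (\<sigma> * f T) = 1 \<longleftrightarrow> f T = 0" using fT cis_arc_len[OF \<sigma>] cis_l_neq_1 by auto
    \<comment> \<open>This removes the exit time: exit through \<open>0\<close> means that some
      nonpositive value occurs before the arc length is reached.\<close>
    have hit0: "f T = 0 \<longleftrightarrow> (\<exists>r\<in>{s..<t}. f r \<le> 0 \<and> (\<forall>q\<in>{s..r}. f q < ?\<Lambda>))"
    proof
      assume "f T = 0"
      moreover have "f q < ?\<Lambda>" if "q \<in> {s..T}" for q
        using before[of q] that \<open>f T = 0\<close> a by (cases "q = T") auto
      ultimately show "\<exists>r\<in>{s..<t}. f r \<le> 0 \<and> (\<forall>q\<in>{s..r}. f q < ?\<Lambda>)"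
        using sT r0 by (intro bexI[of _ T]) auto
    next
      assume "\<exists>r\<in>{s..<t}. f r \<le> 0 \<and> (\<forall>q\<in>{s..r}. f q < ?\<Lambda>)"
      then obtain r where r: "s \<le> r" "f r \<le> 0" "\<forall>q\<in>{s..r}. f q < ?\<Lambda>" by auto
      then have "T \<le> r" using before[of r] by force
      then have "f T < ?\<Lambda>" using r sT by auto
      then show "f T = 0" using fT by simp
    qed
    have "\<not> ereal t \<le> tau l w s (cis (\<sigma> * a))" unfolding tauT using sT r0 by simp
    moreover have "cis (\<sigma> * a) * cis (eps l (cis (\<sigma> * a)) * (w (real_of_ereal (tau l w s (cis (\<sigma> * a)))) - w s)) = 1
        \<longleftrightarrow> f T = 0" unfolding mv tauT using hit by simp
    ultimately show ?thesis
      using False arc_interior_not_endpoint[OF \<sigma> a] hit0[unfolded f_def]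
      unfolding arc_kernel_def local_kernel_def Let_def f_def
      by (auto simp: f_def)
  qed
qed

end

section \<open>Coalescence of the kernel products\<close>

text \<open>The conditions quantify over uncountably many times, yet they cut out intervals of
  \<open>a\<close>: the first is convex in \<open>a\<close>, the second is inherited by smaller
  \<open>a\<close>. Intervals are Borel.\<close>

lemma measurable_arc_kernel:
  assumes "up s t \<in> {0..1}" "um s t \<in> {0..1}"
  shows "arc_kernel l up um w s t \<sigma> \<in> borel \<rightarrow>\<^sub>M prob_algebra circle"
proof -
  let ?f = "\<lambda>a r. a + (w r - w s)"
  let ?A = "{a. \<forall>r\<in>{s..<t}. 0 < ?f a r \<and> ?f a r < arc_len l \<sigma>}"
  let ?B = "{a. \<exists>r\<in>{s..<t}. ?f a r \<le> 0 \<and> (\<forall>q\<in>{s..r}. ?f a q < arc_len l \<sigma>)}"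
  have "?A \<in> sets borel"
  proof (rule real_interval_borel_measurable)
    have "0 < ?f y r \<and> ?f y r < arc_len l \<sigma>"
      if "x \<in> ?A" "z \<in> ?A" "x \<le> y" "y \<le> z" "r \<in> {s..<t}" for x y z r
    proof -
      have "0 < ?f x r" "?f z r < arc_len l \<sigma>" using that by auto
      then show ?thesis using that(3,4) by linarith
    qed
    then show "is_interval ?A" unfolding is_interval_1 by blast
  qed
  moreover have "?B \<in> sets borel"
  proof (rule real_interval_borel_measurable)
    have "y \<in> ?B" if z: "z \<in> ?B" "y \<le> z" for y z
    proof -
      obtain r where r: "r \<in> {s..<t}" "?f z r \<le> 0" "\<forall>q\<in>{s..r}. ?f z q < arc_len l \<sigma>" using z by blast
      have "?f y q < arc_len l \<sigma>" if "q \<in> {s..r}" for q using r(3)[rule_format, OF that] z(2) by linarith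
      moreover have "?f y r \<le> 0" using r(2) z(2) by linarith
      ultimately show ?thesis using r(1) by blast
    qed
    then show "is_interval ?B" unfolding is_interval_1 by blast
  qed
  moreover have "(\<lambda>a. return circle (cis (\<sigma> * ?f a t))) \<in> borel \<rightarrow>\<^sub>M prob_algebra circle"
  proof (rule measurable_compose[OF _ measurable_return_prob_space])
    have "(\<lambda>a. cis (\<sigma> * ?f a t)) \<in> borel_measurable borel"
      by (intro borel_measurable_continuous_onI) (auto simp: cis_conv_exp intro!: continuous_intros)
    then show "(\<lambda>a. cis (\<sigma> * ?f a t)) \<in> borel \<rightarrow>\<^sub>M circle"
      unfolding circle_def by (intro measurable_restrict_space2) auto
  qed
  moreover have "two_point (up s t) (cis b) (cis c) \<in> space (prob_algebra circle)"
    "two_point (um s t) (cis b) (cis c) \<in> space (prob_algebra circle)" for b c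
    using assms by (auto intro!: two_point_prob)
  ultimately show ?thesis
    unfolding arc_kernel_def[abs_def] by (intro measurable_If measurable_const) (auto simp: pred_def)
qed

context kernel_path
begin

text \<open>The kernel is a piecewise function of the angle; on the long arc the coordinate is
  \<open>2 * pi\<close> minus the angle.\<close>

lemma measurable_local_kernel:
  assumes st: "0 \<le> s" "s \<le> t"
  shows "local_kernel l up um w s t \<in> circle \<rightarrow>\<^sub>M prob_algebra circle"
proof -
  let ?K1 = "two_point (up s t) (cis (Wplus w s t)) (cis (- Wplus w s t))"
  let ?Kl = "two_point (um s t) (cis (l + Wminus w s t)) (cis (l - Wminus w s t))"
  let ?G = "\<lambda>\<theta>. if \<theta> = 0 then ?K1 else if \<theta> = l then ?Kl else
    if \<theta> < l then arc_kernel l up um w s t 1 \<theta> else arc_kernel l up um w s t (- 1) (2 * pi - \<theta>)"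
  have [measurable]: "arc_kernel l up um w s t \<sigma> \<in> borel \<rightarrow>\<^sub>M prob_algebra circle" for \<sigma>
    using up um st by (intro measurable_arc_kernel) auto
  have [measurable]: "?K1 \<in> space (prob_algebra circle)" "?Kl \<in> space (prob_algebra circle)"
    using up[OF st(2)] um[OF st(2)] by (auto intro!: two_point_prob)
  have G: "?G \<in> borel \<rightarrow>\<^sub>M prob_algebra circle" by measurable
  have A: "Arg2pi \<in> circle \<rightarrow>\<^sub>M borel" unfolding circle_def by (intro measurable_restrict_space1) measurable
  have "local_kernel l up um w s t z = ?G (Arg2pi z)" if "z \<in> space circle" for z
  proof -
    have "z \<in> sphere 0 1" using that by simp
    then show ?thesis
    proof (cases rule: circle_cases)
      case 1 then show ?thesis using Arg2pi_cis[of 0] by (simp add: local_kernel_def Let_def)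
    next
      case 2 then show ?thesis using l l_pi Arg2pi_cis[of l] cis_l_neq_1 by (simp add: local_kernel_def Let_def)
    next
      case (3 \<sigma> a)
      then have "local_kernel l up um w s t z = arc_kernel l up um w s t \<sigma> a"
        using local_kernel_arc[OF st] by simp
      moreover have "Arg2pi z = (if \<sigma> = 1 then a else 2 * pi - a)" using Arg2pi_arc 3 by simp
      ultimately show ?thesis using 3 l l_pi by (auto simp: arc_len_def split: if_splits)
    qed
  qed
  then show ?thesis using measurable_compose[OF A G] by (subst measurable_cong) auto
qed

text \<open>At a chain time the product ends with the factor from that time to itself, which must be
  the identity; at the endpoints both atoms coincide because the excursions vanish.\<close>

lemma local_kernel_refl:
  assumes s: "0 \<le> s" and z: "z \<in> sphere 0 1"
  shows "local_kernel l up um w s s z = return circle z"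
proof -
  have "Wplus w s s = 0" "Wminus w s s = 0" by (auto simp: Wplus_def Wminus_def path_inf_def path_sup_def)
  moreover from z have ?thesis if "z \<noteq> 1" "z \<noteq> cis l"
  proof (cases rule: circle_cases)
    case (3 \<sigma> a)
    then show ?thesis using local_kernel_arc[OF s order_refl, of \<sigma> a] by (simp add: arc_kernel_def)
  qed (use that in auto)
  ultimately show ?thesis using two_point_same[of "up s s" 1] two_point_same[of "um s s" "cis l"] up[of s s] um[of s s]
    by (cases "z = 1 \<or> z = cis l") (auto simp: local_kernel_def Let_def)
qed

end

text \<open>The distance of the point \<open>cis (- a)\<close> of the long arc from the endpoint \<open>cis (l * (1 - \<sigma>) / 2)\<close>
  opposite to the target.\<close>

definition progress :: "real \<Rightarrow> real \<Rightarrow> real \<Rightarrow> real" where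
  "progress l \<sigma> a = (if \<sigma> = 1 then a else 2 * pi - l - a)"

definition target :: "real \<Rightarrow> real \<Rightarrow> complex" where
  "target l \<sigma> = (if \<sigma> = 1 then cis l else 1)"

text \<open>For \<open>c \<le> 0\<close> this is the whole circle, so that a run of good steps can
  start from any point. For \<open>c > 0\<close> only the closed long arc counts, and at
  \<open>c = 2 * pi - l\<close> just the target remains.\<close>

definition advanced :: "real \<Rightarrow> real \<Rightarrow> real \<Rightarrow> complex set" where
  "advanced l \<sigma> c = {z \<in> sphere 0 1. c \<le> 0 \<or> (\<exists>a\<in>{0..2 * pi - l}. c \<le> progress l \<sigma> a \<and> z = cis (- a))}"

lemma advancedI: "0 \<le> a \<Longrightarrow> a \<le> 2 * pi - l \<Longrightarrow> c \<le> progress l \<sigma> a \<Longrightarrow> cis (- a) \<in> advanced l \<sigma> c"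
  unfolding advanced_def by force

locale flow_path = kernel_path + oscillating_path
begin

lemma target_advanced:
  assumes "\<sigma> \<in> {1, -1}" "c \<le> 2 * pi - l"
  shows "target l \<sigma> \<in> advanced l \<sigma> c"
proof -
  have l2: "0 \<le> 2 * pi - l" using l_pi pi_ge_zero by linarith
  show ?thesis
  proof (cases "\<sigma> = 1")
    case True
    have "cis (- (2 * pi - l)) \<in> advanced l 1 c"
      using assms l2 by (intro advancedI) (auto simp: progress_def)
    then show ?thesis unfolding cis_neg_complement using True by (simp add: target_def)
  next
    case False
    then have "cis (- 0) \<in> advanced l \<sigma> c"
      using assms l2 by (intro advancedI) (auto simp: progress_def)
    then show ?thesis using False by (simp add: target_def)
  qed
qed

lemma advanced_top: "\<sigma> \<in> {1, -1} \<Longrightarrow> z \<in> advanced l \<sigma> (2 * pi - l) \<Longrightarrow> z = target l \<sigma>"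
  using l l_pi cis_neg_complement[of l] by (auto simp: advanced_def progress_def target_def)

text \<open>A particle that stays on the long arc gains the increment of the path, at least
  \<open>l / 2\<close>. One that meets an endpoint lands on the target or at progress
  \<open>l\<close>; the latter suffices because the opposite endpoint is reachable only if
  \<open>c \<le> l / 2\<close>. The bound on \<open>c\<close> ensures that the target itself
  qualifies.\<close>

lemma AE_local_kernel_advanced:
  assumes \<sigma>: "\<sigma> \<in> {1, -1}" and good: "l / 2 \<le> \<sigma> * (w (rt (Suc n)) - w (rt n))"
    and z: "z \<in> advanced l \<sigma> c" and c: "c + l / 2 \<le> 2 * pi - l"
  shows "AE y in local_kernel l up um w (rt n) (rt (Suc n)) z. y \<in> advanced l \<sigma> (c + l / 2)"
proof -
  define s r where "s = rt n" and "r = rt (Suc n)"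
  let ?P = "\<lambda>y. y \<in> advanced l \<sigma> (c + l / 2)"
  let ?K1 = "two_point (up s r) (cis (Wplus w s r)) (cis (- Wplus w s r))"
  let ?Kl = "two_point (um s r) (cis (l + Wminus w s r)) (cis (l - Wminus w s r))"
  have sr: "0 \<le> s" "s < r" using rt_nonneg rt_less_Suc by (auto simp: s_def r_def)
  have good': "l / 2 \<le> \<sigma> * (w r - w s)" using good by (simp add: s_def r_def)
  obtain \<sigma>' where s1: "\<sigma>' \<in> {1, -1}"
    and pos: "\<And>q. q \<in> {s..r} \<Longrightarrow> 0 \<le> \<sigma>' * (w r - w q)" and le: "\<And>q. q \<in> {s..r} \<Longrightarrow> \<sigma>' * (w r - w q) \<le> l"
    and att: "\<exists>u\<in>{s..r}. \<sigma>' * (w r - w u) = l"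
    using rt_step[of n] unfolding s_def r_def by metis
  \<comment> \<open>The net displacement over the step is nonzero, so its sign tells how the step
    ended.\<close>
  have "\<sigma>' = \<sigma>" using pos[of s] s1 \<sigma> good' l sr by auto
  with pos le att obtain u where u: "u \<in> {s..r}" "\<sigma> * (w r - w u) = l"
    and pos: "\<And>q. q \<in> {s..r} \<Longrightarrow> 0 \<le> \<sigma> * (w r - w q)" and le: "\<And>q. q \<in> {s..r} \<Longrightarrow> \<sigma> * (w r - w q) \<le> l"
    by blast
  have W: "Wplus w s r = (if \<sigma> = 1 then l else 0)" "Wminus w s r = (if \<sigma> = 1 then 0 else l)"
  proof -
    have "path_inf w s r = w u \<and> path_sup w s r = w r" if "\<sigma> = 1"
    proof (intro conjI path_inf_eqI path_sup_eqI)
      fix q assume "q \<in> {s..r}"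
      then show "w u \<le> w q" "w q \<le> w r" using pos[of q] le[of q] u that by auto
    qed (use u sr in auto)
    moreover have "path_inf w s r = w r \<and> path_sup w s r = w u" if "\<sigma> = -1"
    proof (intro conjI path_inf_eqI path_sup_eqI)
      fix q assume "q \<in> {s..r}"
      then show "w r \<le> w q" "w q \<le> w u" using pos[of q] le[of q] u that by auto
    qed (use u sr in auto)
    ultimately show "Wplus w s r = (if \<sigma> = 1 then l else 0)" "Wminus w s r = (if \<sigma> = 1 then 0 else l)"
      using \<sigma> u by (auto simp: Wplus_def Wminus_def)
  qed
  have tgt: "?P (target l \<sigma>)" using target_advanced[OF \<sigma> c] by simp
  have K1: "AE y in ?K1. ?P y" if "\<sigma> = 1 \<longrightarrow> c \<le> l / 2"
  proof (rule AE_two_point)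
    show "up s r \<in> {0..1}" using up sr by simp
    show "?P (cis (Wplus w s r))" using tgt \<sigma> by (auto simp: W target_def)
    \<comment> \<open>The atom thrown onto the long arc has progress \<open>l\<close>; it lies on
      that arc because \<open>l \<le> pi\<close>.\<close>
    have "cis (- l) \<in> advanced l 1 (c + l / 2)" if "c \<le> l / 2"
      using that l l_pi by (intro advancedI) (auto simp: progress_def)
    then show "?P (cis (- Wplus w s r))" using that tgt \<sigma> by (auto simp: W target_def)
  qed auto
  have Kl: "AE y in ?Kl. ?P y" if "\<sigma> = -1 \<longrightarrow> c \<le> l / 2"
  proof (rule AE_two_point)
    show "um s r \<in> {0..1}" using um sr by simp
    show "?P (cis (l - Wminus w s r))" using tgt \<sigma> by (auto simp: W target_def)
    \<comment> \<open>The mirror case: \<open>cis (l + l)\<close> in long-arc coordinates, again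
      with progress \<open>l\<close>.\<close>
    have "cis (- (2 * pi - 2 * l)) \<in> advanced l (- 1) (c + l / 2)" if "c \<le> l / 2"
      using that l l_pi by (intro advancedI) (auto simp: progress_def)
    then have "cis (l + l) \<in> advanced l (- 1) (c + l / 2)" if "c \<le> l / 2"
      using that unfolding cis_neg_complement by simp
    then show "?P (cis (l + Wminus w s r))" using that tgt \<sigma> by (auto simp: W target_def)
  qed auto
  have arc: "AE y in arc_kernel l up um w s r \<beta> a. ?P y"
    if \<beta>: "\<beta> \<in> {1, -1}" and a: "0 < a" "a < arc_len l \<beta>" and ca: "c \<le> 0 \<or> \<beta> = -1 \<and> c \<le> progress l \<sigma> a" for \<beta> a
  proof (cases "\<forall>x\<in>{s..<r}. 0 < a + (w x - w s) \<and> a + (w x - w s) < arc_len l \<beta>")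
    case True
    have "u \<noteq> r" using u l by auto
    have "(w \<longlongrightarrow> w r) (at r within {s..r})"
      using continuous_on_subset[OF w, of "{s..r}"] sr by (auto simp: continuous_on)
    then have lim: "((\<lambda>x. a + (w x - w s)) \<longlongrightarrow> a + (w r - w s)) (at_left r)"
      using sr by (auto simp: at_within_Icc_at_left intro!: tendsto_intros)
    have ev: "eventually (\<lambda>x. x \<in> {s..<r}) (at_left r)"
      using sr by (auto simp: eventually_at_left_field intro!: exI[of _ s])
    have "0 \<le> a + (w r - w s)"
      by (rule tendsto_lowerbound[OF lim]) (use ev True in \<open>auto elim!: eventually_mono intro: less_imp_le\<close>)
    moreover have "a + (w r - w s) \<le> arc_len l \<beta>"
      by (rule tendsto_upperbound[OF lim]) (use ev True in \<open>auto elim!: eventually_mono intro: less_imp_le\<close>)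
    moreover have "u \<in> {s..<r}" using u \<open>u \<noteq> r\<close> by auto
    then have "0 < a + (w u - w s)" "a + (w u - w s) < arc_len l \<beta>" using True by auto
    \<comment> \<open>The short arc has length \<open>l\<close>: a point strictly inside it at
      \<open>u\<close> and still in its closure at \<open>r\<close> cannot have moved by
      \<open>l\<close>.\<close>
    ultimately have "\<beta> = -1" and b: "0 \<le> a + (w r - w s)" "a + (w r - w s) \<le> 2 * pi - l"
      using \<beta> u \<sigma> by (auto simp: arc_len_def)
    have "c \<le> progress l \<sigma> a" using ca a \<open>\<beta> = -1\<close> by (auto simp: progress_def arc_len_def)
    then have "?P (cis (- (a + (w r - w s))))"
      using b good' \<sigma> by (intro advancedI) (auto simp: progress_def)
    then have "?P (cis (\<beta> * (a + (w r - w s))))" using \<open>\<beta> = -1\<close> by simp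
    with True show ?thesis unfolding arc_kernel_def by (simp add: AE_return_circle)
  next
    case False
    show ?thesis
    proof (cases "\<exists>x\<in>{s..<r}. a + (w x - w s) \<le> 0 \<and> (\<forall>q\<in>{s..x}. a + (w q - w s) < arc_len l \<beta>)")
      case True
      then obtain x where x: "x \<in> {s..<r}" "a + (w x - w s) \<le> 0" by blast
      \<comment> \<open>Reaching \<open>0\<close> takes a fall of at least \<open>a\<close>. The
        path climbs at most \<open>l\<close> from \<open>x\<close> to \<open>r\<close> and gains at
        least \<open>l / 2\<close> over the step, so the fall is at most
        \<open>l / 2\<close>.\<close>
      have "c \<le> l / 2" if "\<sigma> = 1"
      proof -
        have "c \<le> a" using ca a that by (auto simp: progress_def)
        then show ?thesis using le[of x] x good' that by auto
      qed
      then show ?thesis using K1 False True unfolding arc_kernel_def by auto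
    next
      case nohit: False
      from False obtain x where x: "x \<in> {s..<r}" "a + (w x - w s) \<le> 0 \<or> arc_len l \<beta> \<le> a + (w x - w s)"
        by (auto simp: not_less)
      \<comment> \<open>Since the exit is not through \<open>0\<close>, the other end of the arc is
        reached at \<open>x\<close> or before it.\<close>
      obtain q where q: "q \<in> {s..<r}" "arc_len l \<beta> \<le> a + (w q - w s)"
      proof (cases "arc_len l \<beta> \<le> a + (w x - w s)")
        case False
        with x nohit obtain q where "q \<in> {s..x}" "arc_len l \<beta> \<le> a + (w q - w s)" by (auto simp: not_less)
        with x that[of q] show ?thesis by auto
      qed (use x that[of x] in auto)
      have "c \<le> l / 2" if "\<sigma> = -1"
      proof -
        have "c \<le> arc_len l \<beta> - a" using ca a that by (auto simp: progress_def arc_len_def)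
        then show ?thesis using le[of q] q good' that by auto
      qed
      then show ?thesis using Kl False nohit unfolding arc_kernel_def by auto
    qed
  qed
  have lk: "local_kernel l up um w s r 1 = ?K1" "local_kernel l up um w s r (cis l) = ?Kl"
    using cis_l_neq_1 by (auto simp: local_kernel_def Let_def)
  have lka: "local_kernel l up um w s r (cis (\<beta> * a)) = arc_kernel l up um w s r \<beta> a"
    if "\<beta> \<in> {1, -1}" "0 < a" "a < arc_len l \<beta>" for \<beta> a
    using that sr by (intro local_kernel_arc) auto
  have "AE y in local_kernel l up um w s r z. ?P y"
  proof (cases "c \<le> 0")
    case True
    have "z \<in> sphere 0 1" using z by (auto simp: advanced_def)
    then show ?thesis
    proof (cases rule: circle_cases)
      case 1
      show ?thesis unfolding 1 lk using True l by (intro K1) simp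
    next
      case 2
      show ?thesis unfolding 2 lk using True l by (intro Kl) simp
    next
      case (3 \<beta> a)
      show ?thesis unfolding 3(4) lka[OF 3(1-3)] using True 3 by (intro arc) auto
    qed
  next
    case False
    then obtain a where a: "0 \<le> a" "a \<le> 2 * pi - l" "c \<le> progress l \<sigma> a" "z = cis (- a)"
      using z by (auto simp: advanced_def)
    consider "a = 0" | "a = 2 * pi - l" | "0 < a" "a < 2 * pi - l" using a by linarith
    then show ?thesis
    proof cases
      case 1
      then have "z = 1" using a(4) by simp
      have "\<sigma> \<noteq> 1" using 1 a(3) False by (auto simp: progress_def)
      then show ?thesis unfolding \<open>z = 1\<close> lk by (intro K1) simp
    next
      case 2
      then have "z = cis l" using a(4) cis_neg_complement[of l] by (simp only:)
      have "\<sigma> \<noteq> - 1" using 2 a(3) False by (auto simp: progress_def)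
      then show ?thesis unfolding \<open>z = cis l\<close> lk by (intro Kl) simp
    next
      case 3
      have "z = cis (- 1 * a)" using a(4) by simp
      moreover have "a < arc_len l (- 1)" using 3 by (simp add: arc_len_def)
      moreover have "AE y in local_kernel l up um w s r (cis (- 1 * a)). ?P y"
        using 3(1) calculation(2) a(3) by (subst lka) (auto intro: arc)
      ultimately show ?thesis by (simp only:)
    qed
  qed
  then show ?thesis unfolding s_def r_def .
qed

lemma local_kernel_prob:
  "z \<in> sphere 0 1 \<Longrightarrow> local_kernel l up um w (rt n) (rt (Suc n)) z \<in> space (prob_algebra circle)"
  using measurable_local_kernel[OF rt_nonneg less_imp_le[OF rt_less_Suc]]
  by (rule measurable_space) simp

lemma kernel_product_rt_Suc:
  "kernel_product l up um w (Suc k) (rt n) t z =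
     local_kernel l up um w (rt n) (rt (Suc n)) z \<bind> kernel_product l up um w k (rt (Suc n)) t"
  by (simp add: Let_def rho_rt kernel_comp_def)

lemma measurable_kernel_product:
  "kernel_product l up um w k (rt n) (rt (n + k)) \<in> circle \<rightarrow>\<^sub>M prob_algebra circle"
proof (induction k arbitrary: n)
  case 0
  then show ?case using measurable_local_kernel[OF rt_nonneg order_refl] by simp
next
  case (Suc k)
  have "kernel_product l up um w (Suc k) (rt n) (rt (n + Suc k)) =
      (\<lambda>z. local_kernel l up um w (rt n) (rt (Suc n)) z \<bind> kernel_product l up um w k (rt (Suc n)) (rt (Suc n + k)))"
    by (simp add: Let_def rho_rt kernel_comp_def fun_eq_iff)
  then show ?case
    using measurable_bind_prob_space[OF measurable_local_kernel[OF rt_nonneg less_imp_le[OF rt_less_Suc]] Suc]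
    by (simp only:)
qed

lemma kernel_product_AE_const:
  assumes "z \<in> sphere 0 1" "x \<in> sphere 0 1"
    and "AE y in local_kernel l up um w (rt n) (rt (Suc n)) z.
      kernel_product l up um w k (rt (Suc n)) (rt (Suc n + k)) y = return circle x"
  shows "kernel_product l up um w (Suc k) (rt n) (rt (n + Suc k)) z = return circle x"
proof -
  have "local_kernel l up um w (rt n) (rt (Suc n)) z \<bind> kernel_product l up um w k (rt (Suc n)) (rt (Suc n + k))
      = return circle x"
    by (rule bind_AE_const[OF local_kernel_prob[OF assms(1)] measurable_kernel_product assms(3)]) simp
  then show ?thesis unfolding kernel_product_rt_Suc by simp
qed

lemma target_in_circle: "target l \<sigma> \<in> sphere 0 1" by (simp add: target_def)

text \<open>Each good step raises the level by \<open>l / 2\<close>, and the initial level is chosen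
  so that \<open>k\<close> steps bring it to \<open>2 * pi - l\<close>, where only the target is
  left.\<close>

lemma kernel_product_advanced:
  assumes \<sigma>: "\<sigma> \<in> {1, -1}"
    and good: "\<And>i. i \<in> {n..<n + k} \<Longrightarrow> l / 2 \<le> \<sigma> * (w (rt (Suc i)) - w (rt i))"
    and z: "z \<in> advanced l \<sigma> (2 * pi - l - real k * (l / 2))"
  shows "kernel_product l up um w k (rt n) (rt (n + k)) z = return circle (target l \<sigma>)"
  using good z
proof (induction k arbitrary: n z)
  case 0
  then have "z = target l \<sigma>" using advanced_top \<sigma> by simp
  then show ?case using local_kernel_refl rt_nonneg target_in_circle by simp
next
  case (Suc k)
  have zc: "z \<in> sphere 0 1" using Suc.prems by (auto simp: advanced_def)
  show ?case
  proof (rule kernel_product_AE_const[OF zc target_in_circle])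
    have eq: "2 * pi - l - real (Suc k) * (l / 2) + l / 2 = 2 * pi - l - real k * (l / 2)"
      by (simp add: field_simps)
    have "AE y in local_kernel l up um w (rt n) (rt (Suc n)) z.
        y \<in> advanced l \<sigma> (2 * pi - l - real (Suc k) * (l / 2) + l / 2)"
    proof (rule AE_local_kernel_advanced[OF \<sigma>])
      show "2 * pi - l - real (Suc k) * (l / 2) + l / 2 \<le> 2 * pi - l" unfolding eq using l by simp
    qed (use Suc.prems in auto)
    then show "AE y in local_kernel l up um w (rt n) (rt (Suc n)) z.
        kernel_product l up um w k (rt (Suc n)) (rt (Suc n + k)) y = return circle (target l \<sigma>)"
    proof eventually_elim
      case (elim y)
      then show ?case unfolding eq using Suc.prems by (intro Suc.IH) auto
    qed
  qed
qed

text \<open>The last \<open>k\<close> factors forget their starting point, so the law produced by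
  the first \<open>j\<close> factors is irrelevant.\<close>

lemma kernel_product_const:
  assumes z: "z \<in> sphere 0 1"
    and const: "\<And>z. z \<in> sphere 0 1 \<Longrightarrow> kernel_product l up um w k (rt (n + j)) (rt (n + j + k)) z = return circle x"
    and x: "x \<in> sphere 0 1"
  shows "kernel_product l up um w (j + k) (rt n) (rt (n + (j + k))) z = return circle x"
  using z const
proof (induction j arbitrary: n z)
  case (Suc j)
  have "kernel_product l up um w (Suc (j + k)) (rt n) (rt (n + Suc (j + k))) z = return circle x"
  proof (rule kernel_product_AE_const[OF Suc.prems(1) x], rule AE_I2)
    fix y assume "y \<in> space (local_kernel l up um w (rt n) (rt (Suc n)) z)"
    then have "y \<in> sphere 0 1"
      using local_kernel_prob[OF Suc.prems(1), of n] sets_eq_imp_space_eq[of _ circle]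
      by (auto simp: space_prob_algebra)
    then show "kernel_product l up um w (j + k) (rt (Suc n)) (rt (Suc n + (j + k))) y = return circle x"
      using Suc.prems by (intro Suc.IH) auto
  qed
  then show ?case by simp
qed simp

text \<open>The chain increases strictly, so at one of its times a single index survives in the
  sum.\<close>

lemma flow_kernel_rt:
  assumes z: "z \<in> sphere 0 1"
  shows "flow_kernel l up um w 0 (rt n) z = kernel_product l up um w n 0 (rt n) z"
proof -
  let ?K = "kernel_product l up um w n (rt 0) (rt (0 + n)) z"
  have K: "sets ?K = sets circle"
    using measurable_space[OF measurable_kernel_product, of z n 0] z by (simp add: space_prob_algebra)
  have ind: "indicator {k. rho_iter l w 0 k \<le> ereal (rt n) \<and> ereal (rt n) < rho_iter l w 0 (Suc k)} k
      = (if k = n then 1 else 0 :: ennreal)" for k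
    using rt_strict_mono[of k n] rt_strict_mono[of n k] rt_mono[of "Suc k" n] rt_mono[of k n] rt_less_Suc[of n]
    unfolding rho_iter_rt by (cases k n rule: linorder_cases) (auto simp: indicator_def)
  have "(\<Sum>k. indicator {k. rho_iter l w 0 k \<le> ereal (rt n) \<and> ereal (rt n) < rho_iter l w 0 (Suc k)} k
      * emeasure (kernel_product l up um w k 0 (rt n) z) A) = emeasure ?K A" for A
    unfolding ind by (subst suminf_finite[of "{n}"]) auto
  then have "flow_kernel l up um w 0 (rt n) z = measure_of (space circle) (sets circle) (emeasure ?K)"
    unfolding flow_kernel_def by (simp only:)
  also have "\<dots> = ?K"
    using measure_of_of_measure[of ?K] K sets_eq_imp_space_eq[OF K] by simp
  finally show ?thesis by simp
qed

lemma flow_kernel_target: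
  assumes \<sigma>: "\<sigma> \<in> {1, -1}" and N: "2 * pi \<le> real N * (l / 2)"
    and good: "\<And>i. i \<in> {n..<n + N} \<Longrightarrow> l / 2 \<le> \<sigma> * (w (rt (Suc i)) - w (rt i))"
    and z: "z \<in> sphere 0 1"
  shows "flow_kernel l up um w 0 (rt (n + N)) z = return circle (target l \<sigma>)"
proof -
  \<comment> \<open>By the choice of \<open>N\<close> the initial level is negative, hence
    \<open>advanced\<close> is the whole circle.\<close>
  have "kernel_product l up um w N (rt n) (rt (n + N)) y = return circle (target l \<sigma>)" if "y \<in> sphere 0 1" for y
    using good that N l by (intro kernel_product_advanced[OF \<sigma>]) (auto simp: advanced_def)
  then have "kernel_product l up um w (n + N) (rt 0) (rt (0 + (n + N))) z = return circle (target l \<sigma>)"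
    by (intro kernel_product_const[OF z _ target_in_circle]) simp
  then show ?thesis using flow_kernel_rt[OF z] by simp
qed

end

section \<open>Stopping times\<close>

lemma space_sigma_gen [simp]: "space (sigma_gen \<Omega> I X) = \<Omega>"
  unfolding sigma_gen_def by (rule space_measure_of) auto

lemma sets_sigma_gen:
  "sets (sigma_gen \<Omega> I X) = sigma_sets \<Omega> (\<Union>i\<in>I. {X i -` A \<inter> \<Omega> | A. A \<in> sets borel})"
  unfolding sigma_gen_def by (rule sets_measure_of) auto

lemma space_FW [simp]: "space (FW \<Omega> W s t) = \<Omega>"
  by (simp add: FW_def)

lemma sets_FW_mono: "t \<le> t' \<Longrightarrow> sets (FW \<Omega> W s t) \<subseteq> sets (FW \<Omega> W s t')"
  unfolding FW_def sets_sigma_gen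
  by (intro sigma_sets_mono' UN_mono) (auto intro: order_trans)

lemma FW_increment_measurable:
  assumes "s \<le> u" "u \<le> v" "ereal v \<le> t"
  shows "(\<lambda>\<omega>. W v \<omega> - W u \<omega>) \<in> borel_measurable (FW \<Omega> W s t)"
proof (rule measurableI)
  fix A :: "real set" assume "A \<in> sets borel"
  then show "(\<lambda>\<omega>. W v \<omega> - W u \<omega>) -` A \<inter> space (FW \<Omega> W s t) \<in> sets (FW \<Omega> W s t)"
    unfolding FW_def sets_sigma_gen space_sigma_gen using assms
    by (intro sigma_sets.Basic UN_I[of "(u, v)"]) auto
qed simp

text \<open>Approximation by random times with countably many values. Clamping to
  \<open>{0..t}\<close> keeps every grid index in the range where \<open>X\<close> is known to be
  measurable.\<close>

lemma continuous_process_at_random_time: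
  fixes X :: "real \<Rightarrow> 'a \<Rightarrow> real"
  assumes X [measurable]: "\<And>r. 0 \<le> r \<Longrightarrow> r \<le> t \<Longrightarrow> X r \<in> borel_measurable F"
    and cont: "\<And>\<omega>. \<omega> \<in> space F \<Longrightarrow> continuous_on {0..t} (\<lambda>r. X r \<omega>)"
    and \<sigma> [measurable]: "\<sigma> \<in> borel_measurable F" and \<sigma>_bd: "\<And>\<omega>. \<omega> \<in> space F \<Longrightarrow> 0 \<le> \<sigma> \<omega> \<and> \<sigma> \<omega> \<le> t"
  shows "(\<lambda>\<omega>. X (\<sigma> \<omega>) \<omega>) \<in> borel_measurable F"
proof (rule borel_measurable_LIMSEQ_real)
  define d where "d m x = max 0 (min t (real_of_int \<lfloor>real (Suc m) * x\<rfloor> / real (Suc m)))" for m :: nat and x :: real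
  show "(\<lambda>m. X (d m (\<sigma> \<omega>)) \<omega>) \<longlonglongrightarrow> X (\<sigma> \<omega>) \<omega>" if \<omega>: "\<omega> \<in> space F" for \<omega>
  proof -
    have t: "0 \<le> t" using \<sigma>_bd[OF \<omega>] by simp
    have "(\<lambda>m. real_of_int \<lfloor>real (Suc m) * \<sigma> \<omega>\<rfloor> / real (Suc m)) \<longlonglongrightarrow> \<sigma> \<omega>"
    proof (rule tendsto_sandwich)
      show "\<forall>\<^sub>F m in sequentially. \<sigma> \<omega> - 1 / real (Suc m) \<le> real_of_int \<lfloor>real (Suc m) * \<sigma> \<omega>\<rfloor> / real (Suc m)"
      proof (intro always_eventually allI)
        fix m
        have "real (Suc m) * \<sigma> \<omega> - 1 \<le> real_of_int \<lfloor>real (Suc m) * \<sigma> \<omega>\<rfloor>" by linarith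
        then have "(real (Suc m) * \<sigma> \<omega> - 1) / real (Suc m) \<le> real_of_int \<lfloor>real (Suc m) * \<sigma> \<omega>\<rfloor> / real (Suc m)"
          by (intro divide_right_mono) auto
        then show "\<sigma> \<omega> - 1 / real (Suc m) \<le> real_of_int \<lfloor>real (Suc m) * \<sigma> \<omega>\<rfloor> / real (Suc m)"
          by (simp add: diff_divide_distrib)
      qed
      show "\<forall>\<^sub>F m in sequentially. real_of_int \<lfloor>real (Suc m) * \<sigma> \<omega>\<rfloor> / real (Suc m) \<le> \<sigma> \<omega>"
        by (intro always_eventually allI) (simp add: pos_divide_le_eq mult.commute)
      show "(\<lambda>m. \<sigma> \<omega> - 1 / real (Suc m)) \<longlonglongrightarrow> \<sigma> \<omega>"
        using tendsto_diff[OF tendsto_const lim_1_over_n[THEN LIMSEQ_Suc], of "\<sigma> \<omega>"] by simp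
    qed simp
    then have "(\<lambda>m. d m (\<sigma> \<omega>)) \<longlonglongrightarrow> max 0 (min t (\<sigma> \<omega>))"
      unfolding d_def by (intro tendsto_max tendsto_min tendsto_const)
    moreover have "max 0 (min t (\<sigma> \<omega>)) = \<sigma> \<omega>" using \<sigma>_bd[OF \<omega>] by simp
    ultimately show ?thesis
      using \<sigma>_bd[OF \<omega>] t
      by (intro continuous_on_tendsto_compose[OF cont[OF \<omega>]]) (auto simp: d_def)
  qed
  show "(\<lambda>\<omega>. X (d m (\<sigma> \<omega>)) \<omega>) \<in> borel_measurable F" for m
  proof (cases "0 \<le> t")
    case True
    define e where "e k = max 0 (min t (real_of_int k / real (Suc m)))" for k :: int
    have [measurable]: "X (e k) \<in> borel_measurable F" for k
      using True by (intro X) (auto simp: e_def)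
    have "(\<lambda>\<omega>. X (e \<lfloor>real (Suc m) * \<sigma> \<omega>\<rfloor>) \<omega>) \<in> borel_measurable F"
      by (rule measurable_compose_countable) (measurable)
    then show ?thesis by (simp add: d_def e_def)
  next
    case False
    then have "space F = {}" using \<sigma>_bd by fastforce
    then show ?thesis by (simp add: measurable_def space_empty)
  qed
qed

text \<open>Density of rational points costs an error \<open>1 / (m + 1)\<close>, and compactness
  removes it again. The points are given as fractions of the interval, so the index set stays fixed
  when \<open>s\<close> is random.\<close>

lemma oscillates_countable:
  assumes cont: "continuous_on {s..t} w" and st: "s \<le> t"
  shows "oscillates l w s t \<longleftrightarrow>
    (\<forall>m::nat. \<exists>p::rat\<in>{0..1}. \<exists>q::rat\<in>{0..1}. l - 1 / real (Suc m) \<le> w (s + of_rat q * (t - s)) - w (s + of_rat p * (t - s)))"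
    (is "_ \<longleftrightarrow> ?R")
proof
  assume "oscillates l w s t"
  then obtain u v where uv: "u \<in> {s..t}" "v \<in> {s..t}" "l \<le> w v - w u" unfolding oscillates_def by blast
  have approx: "\<exists>p::rat\<in>{0..1}. \<bar>w (s + of_rat p * (t - s)) - w x\<bar> < e" if x: "x \<in> {s..t}" and e: "0 < e" for x e
  proof (cases "s = t")
    case True
    then show ?thesis using x e by (intro bexI[of _ 0]) auto
  next
    case False
    let ?g = "\<lambda>p. w (s + p * (t - s))"
    have st': "s < t" using st False by simp
    have g: "continuous_on {0..1} ?g"
    proof (rule continuous_on_compose2[OF cont])
      show "(\<lambda>p. s + p * (t - s)) ` {0..1} \<subseteq> {s..t}"
        using st' mult_left_le_one_le[of "t - s"] by (auto simp: image_subset_iff add.commute[of s] le_diff_eq[symmetric])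
    qed (intro continuous_intros)
    define y where "y = (x - s) / (t - s)"
    have "s + y * (t - s) = x" using st' by (simp add: y_def)
    then have y: "y \<in> {0..1}" "?g y = w x" using x st' by (auto simp: y_def divide_simps)
    obtain d where d: "d > 0" "\<And>p. p \<in> {0..1} \<Longrightarrow> dist p y < d \<Longrightarrow> dist (?g p) (?g y) < e"
      using g y(1) e unfolding continuous_on_iff by blast
    have "max 0 (y - d) < min 1 (y + d)" using d(1) y(1) by auto
    then obtain p :: rat where "max 0 (y - d) < of_rat p" "of_rat p < min 1 (y + d)" using of_rat_dense by blast
    then show ?thesis using d(2)[of "of_rat p"] y(2) by (intro bexI[of _ p]) (auto simp: dist_real_def less_imp_le)
  qed
  show ?R
  proof
    fix m
    define e where "e = 1 / real (Suc m)"
    then have e: "0 < e / 2" by simp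
    obtain p q :: rat where pq: "p \<in> {0..1}" "q \<in> {0..1}"
      "\<bar>w (s + of_rat p * (t - s)) - w u\<bar> < e / 2" "\<bar>w (s + of_rat q * (t - s)) - w v\<bar> < e / 2"
      using approx[OF uv(1) e] approx[OF uv(2) e] by blast
    then have "l - e \<le> w (s + of_rat q * (t - s)) - w (s + of_rat p * (t - s))"
      using uv(3) by linarith
    then show "\<exists>p::rat\<in>{0..1}. \<exists>q::rat\<in>{0..1}. l - 1 / real (Suc m) \<le> w (s + of_rat q * (t - s)) - w (s + of_rat p * (t - s))"
      using pq(1,2) unfolding e_def by blast
  qed
next
  assume R: ?R
  \<comment> \<open>The maximum minus the minimum dominates every increment, so one pair
    \<open>u\<close>, \<open>v\<close> serves for all \<open>m\<close>.\<close>
  obtain u where u: "u \<in> {s..t}" "\<And>q. q \<in> {s..t} \<Longrightarrow> w u \<le> w q" using path_inf_attained[OF cont st] by metis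
  obtain v where v: "v \<in> {s..t}" "\<And>q. q \<in> {s..t} \<Longrightarrow> w q \<le> w v" using path_sup_attained[OF cont st] by metis
  have "l - 1 / real (Suc m) \<le> w v - w u" for m
  proof -
    obtain p q :: rat where "p \<in> {0..1}" "q \<in> {0..1}" "l - 1 / real (Suc m) \<le> w (s + of_rat q * (t - s)) - w (s + of_rat p * (t - s))"
      using R by blast
    moreover have "s + of_rat x * (t - s) \<in> {s..t}" if "x \<in> {0..1}" for x :: rat
      using that st mult_left_le_one_le[of "t - s" "of_rat x"] by auto
    ultimately show ?thesis using u(2) v(2) by (smt (verit))
  qed
  moreover have "(\<lambda>m. l - 1 / real (Suc m)) \<longlonglongrightarrow> l"
    using tendsto_diff[OF tendsto_const LIMSEQ_Suc[OF lim_1_over_n], of l] by simp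
  ultimately have "l \<le> w v - w u" by (intro LIMSEQ_le_const2) auto
  then show "oscillates l w s t" unfolding oscillates_def using u v by blast
qed


lemma INF_nat_mono_attained:
  fixes f :: "nat \<Rightarrow> 'b :: complete_linorder"
  assumes "mono f" "n \<in> A"
  obtains m where "m \<in> A" "(INF n\<in>A. f n) = f m"
proof
  show "(LEAST n. n \<in> A) \<in> A" using assms(2) by (rule LeastI)
  then show "(INF n\<in>A. f n) = f (LEAST n. n \<in> A)"
    by (intro antisym INF_lower INF_greatest monoD[OF assms(1)] Least_le)
qed

text \<open>The first time \<open>\<rho>\<^sup>n\<^sup>+\<^sup>N\<close> with \<open>n \<ge> k\<close> such that \<open>w\<close> moves by at least \<open>l / 2\<close> in the
  direction \<open>\<sigma>\<close> during each of the last \<open>N\<close> steps of the chain. If \<open>rho_iter\<close> takes the value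
  infinity, the junk value \<open>w 0\<close> in \<open>good_run\<close> is harmless, because the infimum ignores such \<open>n\<close>.\<close>

definition good_run :: "real \<Rightarrow> nat \<Rightarrow> real \<Rightarrow> (real \<Rightarrow> real) \<Rightarrow> nat \<Rightarrow> bool" where
  "good_run l N \<sigma> w n \<longleftrightarrow> (\<forall>i\<in>{n..<n + N}.
     l / 2 \<le> \<sigma> * (w (real_of_ereal (rho_iter l w 0 (Suc i))) - w (real_of_ereal (rho_iter l w 0 i))))"

definition good_time :: "real \<Rightarrow> nat \<Rightarrow> real \<Rightarrow> nat \<Rightarrow> (real \<Rightarrow> real) \<Rightarrow> ennreal" where
  "good_time l N \<sigma> k w = (INF n\<in>{n. k \<le> n \<and> good_run l N \<sigma> w n}. e2ennreal (rho_iter l w 0 (n + N)))"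

lemma good_time_mono: "j \<le> k \<Longrightarrow> good_time l N \<sigma> j w \<le> good_time l N \<sigma> k w"
  unfolding good_time_def by (rule INF_superset_mono) auto

lemma good_time_attained:
  assumes "k \<le> n" "good_run l N \<sigma> w n"
  obtains m where "k \<le> m" "good_run l N \<sigma> w m" "good_time l N \<sigma> k w = e2ennreal (rho_iter l w 0 (m + N))"
proof -
  have "mono (\<lambda>n. e2ennreal (rho_iter l w 0 (n + N)))"
    by (intro monoI e2ennreal_mono rho_iter_mono) simp
  from INF_nat_mono_attained[OF this, of n "{n. k \<le> n \<and> good_run l N \<sigma> w n}"] assms that
  show thesis unfolding good_time_def by blast
qed

text \<open>The infimum is attained at the least admissible index, so the event becomes a countable
  union over \<open>n\<close>.\<close>

lemma good_time_le_iff: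
  assumes x: "0 \<le> x"
  shows "good_time l N \<sigma> k w \<le> ennreal x \<longleftrightarrow>
    (\<exists>n\<ge>k. good_run l N \<sigma> w n \<and> rho_iter l w 0 (n + N) \<le> ereal x)"
proof -
  have le: "e2ennreal (rho_iter l w 0 n) \<le> ennreal x \<longleftrightarrow> rho_iter l w 0 n \<le> ereal x" for n
    using x rho_iter_ge[of 0 l w n]
    by (simp add: less_eq_ennreal.rep_eq enn2ereal_e2ennreal zero_ereal_def[symmetric])
  show ?thesis
  proof
    assume a: "good_time l N \<sigma> k w \<le> ennreal x"
    then have "good_time l N \<sigma> k w \<noteq> top" by (metis ennreal_less_top leD)
    then obtain n where "k \<le> n" "good_run l N \<sigma> w n"
      unfolding good_time_def by (cases "{n. k \<le> n \<and> good_run l N \<sigma> w n} = {}") auto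
    then obtain m where "k \<le> m" "good_run l N \<sigma> w m"
      "good_time l N \<sigma> k w = e2ennreal (rho_iter l w 0 (m + N))" by (rule good_time_attained)
    with a show "\<exists>n\<ge>k. good_run l N \<sigma> w n \<and> rho_iter l w 0 (n + N) \<le> ereal x" by (auto simp: le)
  next
    assume "\<exists>n\<ge>k. good_run l N \<sigma> w n \<and> rho_iter l w 0 (n + N) \<le> ereal x"
    then obtain n where n: "k \<le> n" "good_run l N \<sigma> w n" "rho_iter l w 0 (n + N) \<le> ereal x" by blast
    then have "good_time l N \<sigma> k w \<le> e2ennreal (rho_iter l w 0 (n + N))"
      unfolding good_time_def by (intro INF_lower) auto
    then show "good_time l N \<sigma> k w \<le> ennreal x" using le n(3) order_trans by blast
  qed
qed

section \<open>Adaptedness to the filtration generated by the increments\<close>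

context
  fixes l :: real and \<Omega> :: "'a set" and W :: "real \<Rightarrow> 'a \<Rightarrow> real"
  assumes l: "0 < l" and W0: "\<And>\<omega>. \<omega> \<in> \<Omega> \<Longrightarrow> W 0 \<omega> = 0"
    and cont: "\<And>\<omega>. \<omega> \<in> \<Omega> \<Longrightarrow> continuous_on {0..} (\<lambda>t. W t \<omega>)"
begin

private abbreviation "F t \<equiv> FW \<Omega> W 0 (ereal t)"
private abbreviation "R n \<omega> \<equiv> rho_iter l (\<lambda>t. W t \<omega>) 0 n"

lemma FW_at_random_time:
  assumes "\<tau> \<in> borel_measurable (F t)" "\<And>\<omega>. \<omega> \<in> \<Omega> \<Longrightarrow> 0 \<le> \<tau> \<omega> \<and> \<tau> \<omega> \<le> t"
  shows "(\<lambda>\<omega>. W (\<tau> \<omega>) \<omega>) \<in> borel_measurable (F t)"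
proof (rule continuous_process_at_random_time[OF _ _ assms(1)])
  show "W r \<in> borel_measurable (F t)" if "0 \<le> r" "r \<le> t" for r
  proof -
    \<comment> \<open>The filtration knows increments only; \<open>W 0 = 0\<close> at every sample
      point turns them into values.\<close>
    have "(\<lambda>\<omega>. W r \<omega> - W 0 \<omega>) \<in> borel_measurable (F t)"
      using that by (intro FW_increment_measurable) auto
    then show ?thesis by (rule measurable_cong[THEN iffD1, rotated]) (simp add: W0)
  qed
  show "continuous_on {0..t} (\<lambda>r. W r \<omega>)" if "\<omega> \<in> space (F t)" for \<omega>
    using that by (intro continuous_on_subset[OF cont]) auto
qed (use assms(2) in auto)

lemma R_nonneg: "0 \<le> R n \<omega>"
  using rho_iter_ge[of 0 l _ n] by (simp add: zero_ereal_def)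

text \<open>Below level \<open>t\<close> stopping changes nothing, and the event at level
  \<open>a < t\<close> already lies in the smaller sigma-algebra \<open>F a\<close>.\<close>

lemma FW_stopped_rho_iter:
  assumes "\<And>t. 0 \<le> t \<Longrightarrow> {\<omega> \<in> \<Omega>. R n \<omega> \<le> ereal t} \<in> sets (F t)" and t: "0 \<le> t"
  shows "(\<lambda>\<omega>. real_of_ereal (min (R n \<omega>) (ereal t))) \<in> borel_measurable (F t)"
  unfolding borel_measurable_iff_le
proof
  fix a
  have conv: "real_of_ereal (min (R n \<omega>) (ereal t)) \<le> a \<longleftrightarrow> t \<le> a \<or> R n \<omega> \<le> ereal a" for \<omega>
    using R_nonneg[of \<omega> n] by (cases "R n \<omega>") (auto simp: min_def)
  consider "t \<le> a" | "a < 0" | "0 \<le> a" "a < t" by linarith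
  then show "{\<omega> \<in> space (F t). real_of_ereal (min (R n \<omega>) (ereal t)) \<le> a} \<in> sets (F t)"
  proof cases
    case 1
    then have "{\<omega> \<in> space (F t). real_of_ereal (min (R n \<omega>) (ereal t)) \<le> a} = space (F t)"
      unfolding conv by auto
    then show ?thesis by (simp only: sets.top)
  next
    case 2
    have "\<not> R n \<omega> \<le> ereal a" for \<omega>
      using R_nonneg[of \<omega> n] 2 by (metis ereal_less_eq(5) not_le order_trans)
    then have "{\<omega> \<in> space (F t). real_of_ereal (min (R n \<omega>) (ereal t)) \<le> a} = {}"
      unfolding conv using 2 t by auto
    then show ?thesis by (simp only: sets.empty_sets)
  next
    case 3
    then have "{\<omega> \<in> space (F t). real_of_ereal (min (R n \<omega>) (ereal t)) \<le> a} = {\<omega> \<in> \<Omega>. R n \<omega> \<le> ereal a}"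
      unfolding conv by auto
    then show ?thesis using assms(1)[of a] 3 sets_FW_mono[of "ereal a" "ereal t" \<Omega> W 0] by auto
  qed
qed

text \<open>The next time is at most \<open>t\<close> exactly if the current one is and the path
  oscillates by \<open>l\<close> between it and \<open>t\<close>. The current time may be replaced
  by its stopped version, which is measurable at time \<open>t\<close>.\<close>

lemma FW_rho_iter_le: "0 \<le> t \<Longrightarrow> {\<omega> \<in> \<Omega>. R n \<omega> \<le> ereal t} \<in> sets (F t)"
proof (induction n arbitrary: t)
  case 0
  then have "{\<omega> \<in> \<Omega>. R 0 \<omega> \<le> ereal t} = space (F t)" by auto
  then show ?case by (simp only: sets.top)
next
  case (Suc n)
  define s where "s \<omega> = real_of_ereal (min (R n \<omega>) (ereal t))" for \<omega>
  have [measurable]: "s \<in> borel_measurable (F t)"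
    unfolding s_def using Suc by (rule FW_stopped_rho_iter)
  have s: "0 \<le> s \<omega>" "s \<omega> \<le> t" for \<omega>
    using R_nonneg[of \<omega> n] Suc.prems unfolding s_def by (cases "R n \<omega>"; auto simp: min_def)+
  have iff: "R (Suc n) \<omega> \<le> ereal t \<longleftrightarrow> R n \<omega> \<le> ereal t \<and> oscillates l (\<lambda>t. W t \<omega>) (s \<omega>) t"
    if \<omega>: "\<omega> \<in> \<Omega>" for \<omega>
  proof (cases "R n \<omega>")
    case (real r)
    then have "0 \<le> r" using R_nonneg[of \<omega> n] by simp
    then have "R (Suc n) \<omega> \<le> ereal t \<longleftrightarrow> oscillates l (\<lambda>t. W t \<omega>) r t"
      using real rho_le_iff[OF cont[OF \<omega>] _ l] by simp
    \<comment> \<open>For \<open>r > t\<close> the interval is empty, so the oscillation alone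
      forces \<open>r \<le> t\<close>.\<close>
    moreover have "r \<le> t" if "oscillates l (\<lambda>t. W t \<omega>) r t" using that by (auto simp: oscillates_def)
    ultimately show ?thesis using real by (auto simp: s_def min_def)
  qed (use R_nonneg[of \<omega> n] in auto)
  have [measurable]: "(\<lambda>\<omega>. W (s \<omega> + of_rat p * (t - s \<omega>)) \<omega>) \<in> borel_measurable (F t)" if "p \<in> {0..1}" for p :: rat
  proof (rule FW_at_random_time)
    show "0 \<le> s \<omega> + of_rat p * (t - s \<omega>) \<and> s \<omega> + of_rat p * (t - s \<omega>) \<le> t" for \<omega>
      using s[of \<omega>] that mult_left_le_one_le[of "t - s \<omega>" "of_rat p"] by auto
  qed measurable
  have osc: "oscillates l (\<lambda>t. W t \<omega>) (s \<omega>) t \<longleftrightarrow> (\<forall>m::nat. \<exists>p::rat\<in>{0..1}. \<exists>q::rat\<in>{0..1}.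
      l - 1 / real (Suc m) \<le> W (s \<omega> + of_rat q * (t - s \<omega>)) \<omega> - W (s \<omega> + of_rat p * (t - s \<omega>)) \<omega>)" if \<omega>: "\<omega> \<in> \<Omega>" for \<omega>
    using s[of \<omega>] by (intro oscillates_countable continuous_on_subset[OF cont[OF \<omega>]]) auto
  have "{\<omega> \<in> \<Omega>. R (Suc n) \<omega> \<le> ereal t} = {\<omega> \<in> \<Omega>. R n \<omega> \<le> ereal t} \<inter>
      {\<omega> \<in> space (F t). \<forall>m::nat. \<exists>p::rat\<in>{0..1}. \<exists>q::rat\<in>{0..1}.
      l - 1 / real (Suc m) \<le> W (s \<omega> + of_rat q * (t - s \<omega>)) \<omega> - W (s \<omega> + of_rat p * (t - s \<omega>)) \<omega>}"
    using iff osc by (auto simp del: rho_iter.simps)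
  also have "\<dots> \<in> sets (F t)"
  proof (rule sets.Int)
    have "Measurable.pred (F t) (\<lambda>\<omega>. \<forall>m::nat. \<exists>p::rat\<in>{0..1}. \<exists>q::rat\<in>{0..1}.
      l - 1 / real (Suc m) \<le> W (s \<omega> + of_rat q * (t - s \<omega>)) \<omega> - W (s \<omega> + of_rat p * (t - s \<omega>)) \<omega>)"
      by measurable
    then show "{\<omega> \<in> space (F t). \<forall>m::nat. \<exists>p::rat\<in>{0..1}. \<exists>q::rat\<in>{0..1}.
      l - 1 / real (Suc m) \<le> W (s \<omega> + of_rat q * (t - s \<omega>)) \<omega> - W (s \<omega> + of_rat p * (t - s \<omega>)) \<omega>} \<in> sets (F t)"
      unfolding pred_def .
  qed (use Suc in auto)
  finally show ?case .
qed

lemma stopping_time_good_time: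
  "stopping_time (\<lambda>t. FW \<Omega> W 0 (enn2ereal t)) (\<lambda>\<omega>. good_time l N \<sigma> k (\<lambda>t. W t \<omega>))"
proof (rule stopping_timeI)
  fix t :: ennreal
  show "Measurable.pred (FW \<Omega> W 0 (enn2ereal t)) (\<lambda>\<omega>. good_time l N \<sigma> k (\<lambda>t. W t \<omega>) \<le> t)"
  proof (cases t)
    case (real x)
    have F: "enn2ereal t = ereal x" using real by simp
    define s where "s n \<omega> = real_of_ereal (min (R n \<omega>) (ereal x))" for n \<omega>
    have [measurable]: "s n \<in> borel_measurable (F x)" for n
      unfolding s_def by (rule FW_stopped_rho_iter[OF FW_rho_iter_le real(1)])
    have [measurable]: "(\<lambda>\<omega>. W (s n \<omega>) \<omega>) \<in> borel_measurable (F x)" for n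
    proof (rule FW_at_random_time)
      show "0 \<le> s n \<omega> \<and> s n \<omega> \<le> x" for \<omega>
        using R_nonneg[of \<omega> n] real unfolding s_def by (cases "R n \<omega>"; auto simp: min_def)
    qed measurable
    \<comment> \<open>Once the last time of the run is at most \<open>x\<close>, stopping at
      \<open>x\<close> affects none of the earlier ones.\<close>
    have s_eq: "s i \<omega> = real_of_ereal (R i \<omega>)" if "R (n + N) \<omega> \<le> ereal x" "i \<le> n + N" for i n \<omega>
      using order_trans[OF rho_iter_mono[OF that(2)] that(1)] by (simp add: s_def min_absorb1)
    have "{\<omega> \<in> \<Omega>. good_time l N \<sigma> k (\<lambda>t. W t \<omega>) \<le> t} =
        (\<Union>n\<in>{k..}. {\<omega> \<in> \<Omega>. R (n + N) \<omega> \<le> ereal x} \<inter>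
          {\<omega> \<in> space (F x). \<forall>i\<in>{n..<n + N}. l / 2 \<le> \<sigma> * (W (s (Suc i) \<omega>) \<omega> - W (s i \<omega>) \<omega>)})"
      unfolding real(2) good_time_le_iff[OF real(1)] good_run_def
      using s_eq by (auto simp del: rho_iter.simps; fastforce simp del: rho_iter.simps)
    also have "\<dots> \<in> sets (F x)"
    proof (intro sets.countable_UN'' sets.Int)
      show "{\<omega> \<in> \<Omega>. R (n + N) \<omega> \<le> ereal x} \<in> sets (F x)" for n
        using FW_rho_iter_le real by blast
      show "{\<omega> \<in> space (F x). \<forall>i\<in>{n..<n + N}. l / 2 \<le> \<sigma> * (W (s (Suc i) \<omega>) \<omega> - W (s i \<omega>) \<omega>)} \<in> sets (F x)" for n
        by measurable
    qed simp
    finally show ?thesis unfolding F pred_def by simp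
  next
    case top
    then show ?thesis by simp
  qed
qed

end

section \<open>Steadily increasing blocks of Brownian motion\<close>

text \<open>Only increments inside the cell from \<open>i * h\<close> to \<open>(i + 1) * h\<close>
  enter, which makes different cells independent and equally likely to be steady.\<close>

definition steady_cell :: "real \<Rightarrow> real \<Rightarrow> real \<Rightarrow> real \<Rightarrow> (real \<Rightarrow> real) \<Rightarrow> nat \<Rightarrow> bool" where
  "steady_cell \<sigma> h \<eta> c w i \<longleftrightarrow>
    (\<forall>r\<in>{0..h}. \<bar>w (real i * h + r) - w (real i * h)\<bar> \<le> \<eta>) \<and>
    c \<le> \<sigma> * (w (real i * h + h) - w (real i * h))"

text \<open>The discretisation with finitely many increments, to which the independence clause of
  Brownian motion applies directly.\<close>

definition dyadic_cell :: "nat \<Rightarrow> real \<Rightarrow> real \<Rightarrow> real \<Rightarrow> real \<Rightarrow> (real \<Rightarrow> real) \<Rightarrow> nat \<Rightarrow> bool" where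
  "dyadic_cell n \<sigma> h \<eta> c w i \<longleftrightarrow>
    (\<forall>j\<le>2 ^ n. \<bar>w (real i * h + real j * (h / 2 ^ n)) - w (real i * h)\<bar> \<le> \<eta>) \<and>
    c \<le> \<sigma> * (w (real i * h + h) - w (real i * h))"

lemma dyadic_cell_Suc: "dyadic_cell (Suc n) \<sigma> h \<eta> c w i \<Longrightarrow> dyadic_cell n \<sigma> h \<eta> c w i"
proof -
  assume a: "dyadic_cell (Suc n) \<sigma> h \<eta> c w i"
  have "\<bar>w (real i * h + real j * (h / 2 ^ n)) - w (real i * h)\<bar> \<le> \<eta>" if "j \<le> 2 ^ n" for j
  proof -
    have "real (2 * j) * (h / 2 ^ Suc n) = real j * (h / 2 ^ n)" by simp
    then show ?thesis using a that unfolding dyadic_cell_def by (metis mult_le_mono2 power_Suc)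
  qed
  then show ?thesis using a by (simp add: dyadic_cell_def)
qed

lemma dyadic_cell_antimono: "m \<le> n \<Longrightarrow> dyadic_cell n \<sigma> h \<eta> c w i \<Longrightarrow> dyadic_cell m \<sigma> h \<eta> c w i"
  by (induction n rule: dec_induct) (auto dest: dyadic_cell_Suc)

text \<open>Every point of the cell is a limit of dyadic points from below, and the weak inequality
  with \<open>\<eta>\<close> survives the limit.\<close>

lemma steady_cell_iff_dyadic:
  assumes h: "0 < h" and w: "continuous_on {0..} w"
  shows "steady_cell \<sigma> h \<eta> c w i \<longleftrightarrow> (\<forall>n. dyadic_cell n \<sigma> h \<eta> c w i)"
proof
  assume s: "steady_cell \<sigma> h \<eta> c w i"
  have "real j * (h / 2 ^ n) \<in> {0..h}" if "j \<le> 2 ^ n" for j n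
  proof -
    have "real j \<le> 2 ^ n" using that by (metis of_nat_le_iff of_nat_numeral of_nat_power)
    then show ?thesis using h by (simp add: field_simps)
  qed
  then show "\<forall>n. dyadic_cell n \<sigma> h \<eta> c w i" using s by (auto simp: steady_cell_def dyadic_cell_def)
next
  assume d: "\<forall>n. dyadic_cell n \<sigma> h \<eta> c w i"
  have "\<bar>w (real i * h + r) - w (real i * h)\<bar> \<le> \<eta>" if r: "r \<in> {0..h}" for r
  proof -
    define j where "j n = nat \<lfloor>r / h * 2 ^ n\<rfloor>" for n
    have "j n \<le> 2 ^ n" for n
    proof -
      have "r / h * 2 ^ n \<le> 1 * 2 ^ n" using r h by (intro mult_right_mono) auto
      then have "\<lfloor>r / h * 2 ^ n\<rfloor> \<le> 2 ^ n" by (metis floor_le_iff floor_mono floor_numeral_power mult_1 of_int_floor_le of_int_numeral of_int_power floor_of_int)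
      then show ?thesis unfolding j_def by (metis nat_le_iff of_nat_numeral of_nat_power)
    qed
    then have bd: "\<bar>w (real i * h + real (j n) * (h / 2 ^ n)) - w (real i * h)\<bar> \<le> \<eta>" for n
      using d by (auto simp: dyadic_cell_def)
    have rj: "real (j n) = real_of_int \<lfloor>r / h * 2 ^ n\<rfloor>" for n using r h by (simp add: j_def)
    have "(\<lambda>n. real (j n) * (h / 2 ^ n)) \<longlonglongrightarrow> r"
    proof (rule tendsto_sandwich)
      have "r - h / 2 ^ n \<le> real (j n) * (h / 2 ^ n)" for n
      proof -
        have "(r / h * 2 ^ n - 1) * (h / 2 ^ n) \<le> real (j n) * (h / 2 ^ n)"
          unfolding rj using h by (intro mult_right_mono) (linarith, simp)
        moreover have "(r / h * 2 ^ n - 1) * (h / 2 ^ n) = r - h / 2 ^ n" using h by (simp add: field_simps)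
        ultimately show ?thesis by simp
      qed
      then show "\<forall>\<^sub>F n in sequentially. r - h / 2 ^ n \<le> real (j n) * (h / 2 ^ n)" by simp
      have "real (j n) * (h / 2 ^ n) \<le> r" for n
      proof -
        have "real (j n) * (h / 2 ^ n) \<le> (r / h * 2 ^ n) * (h / 2 ^ n)"
          unfolding rj using h by (intro mult_right_mono) auto
        then show ?thesis using h by simp
      qed
      then show "\<forall>\<^sub>F n in sequentially. real (j n) * (h / 2 ^ n) \<le> r" by simp
      have "(\<lambda>n. h / 2 ^ n) \<longlonglongrightarrow> 0"
        using tendsto_mult[OF tendsto_const LIMSEQ_realpow_zero[of "1/2"], of h] by (simp add: power_one_over)
      then show "(\<lambda>n. r - h / 2 ^ n) \<longlonglongrightarrow> r" using tendsto_diff[OF tendsto_const, of _ 0 sequentially r] by simp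
    qed simp
    then have "(\<lambda>n. real i * h + real (j n) * (h / 2 ^ n)) \<longlonglongrightarrow> real i * h + r" by (intro tendsto_intros)
    then have "(\<lambda>n. w (real i * h + real (j n) * (h / 2 ^ n))) \<longlonglongrightarrow> w (real i * h + r)"
      using r h by (intro continuous_on_tendsto_compose[OF w]) auto
    then have "(\<lambda>n. \<bar>w (real i * h + real (j n) * (h / 2 ^ n)) - w (real i * h)\<bar>) \<longlonglongrightarrow> \<bar>w (real i * h + r) - w (real i * h)\<bar>"
      by (intro tendsto_intros)
    then show ?thesis by (rule LIMSEQ_le_const2) (use bd in auto)
  qed
  then show "steady_cell \<sigma> h \<eta> c w i" using d by (auto simp: steady_cell_def dyadic_cell_def)
qed

text \<open>Partial sums of increments instead of path values: every cell then tests the same Borel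
  set on its own \<open>2 ^ n\<close> coordinates.\<close>

definition walk_event :: "nat \<Rightarrow> real \<Rightarrow> real \<Rightarrow> real \<Rightarrow> (nat \<Rightarrow> real) \<Rightarrow> bool" where
  "walk_event n \<sigma> \<eta> c x \<longleftrightarrow> (\<forall>j\<in>{..2 ^ n}. \<bar>\<Sum>k<j. x k\<bar> \<le> \<eta>) \<and> c \<le> \<sigma> * (\<Sum>k<2 ^ n. x k)"

lemma walk_event_cong: "(\<And>k. k < 2 ^ n \<Longrightarrow> x k = y k) \<Longrightarrow> walk_event n \<sigma> \<eta> c x = walk_event n \<sigma> \<eta> c y"
proof -
  assume xy: "\<And>k. k < 2 ^ n \<Longrightarrow> x k = y k"
  have "(\<Sum>k<j. x k) = (\<Sum>k<j. y k)" if "j \<le> 2 ^ n" for j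
    using that xy by (intro sum.cong) auto
  then show ?thesis unfolding walk_event_def by auto
qed

lemma dyadic_cell_walk:
  "dyadic_cell n \<sigma> h \<eta> c w i \<longleftrightarrow> walk_event n \<sigma> \<eta> c
     (\<lambda>k. w (real (Suc (i * 2 ^ n + k)) * (h / 2 ^ n)) - w (real (i * 2 ^ n + k) * (h / 2 ^ n)))"
proof -
  have eq: "real (i * 2 ^ n + j) * (h / 2 ^ n) = real i * h + real j * (h / 2 ^ n)" for j
    by (simp add: field_simps)
  have "(\<Sum>k<j. w (real (Suc (i * 2 ^ n + k)) * (h / 2 ^ n)) - w (real (i * 2 ^ n + k) * (h / 2 ^ n)))
      = w (real i * h + real j * (h / 2 ^ n)) - w (real i * h)" for j
    using sum_lessThan_telescope[of "\<lambda>k. w (real (i * 2 ^ n + k) * (h / 2 ^ n))" j] eq[of j] eq[of 0] by simp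
  then show ?thesis unfolding walk_event_def dyadic_cell_def by (simp add: Ball_def)
qed

section \<open>Independence of cells through grid increments\<close>

definition grid_incr :: "(real \<Rightarrow> 'a \<Rightarrow> real) \<Rightarrow> real \<Rightarrow> nat \<Rightarrow> nat \<Rightarrow> 'a \<Rightarrow> real" where
  "grid_incr W h n k \<omega> = W (real (Suc k) * (h / 2 ^ n)) \<omega> - W (real k * (h / 2 ^ n)) \<omega>"

context prob_space
begin

context
  fixes W :: "real \<Rightarrow> 'a \<Rightarrow> real"
  assumes bm: "standard_brownian_motion W"
begin

lemma bm_measurable: "0 \<le> t \<Longrightarrow> W t \<in> borel_measurable M"
  using bm unfolding standard_brownian_motion_def by blast

lemma bm_0: "\<omega> \<in> space M \<Longrightarrow> W 0 \<omega> = 0"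
  using bm unfolding standard_brownian_motion_def by blast

lemma bm_continuous: "\<omega> \<in> space M \<Longrightarrow> continuous_on {0..} (\<lambda>t. W t \<omega>)"
  using bm unfolding standard_brownian_motion_def by blast

lemma bm_normal: "0 \<le> s \<Longrightarrow> s < t \<Longrightarrow>
    distributed M lborel (\<lambda>\<omega>. W t \<omega> - W s \<omega>) (normal_density 0 (sqrt (t - s)))"
  using bm unfolding standard_brownian_motion_def by blast

lemma bm_indep: "0 \<le> t 0 \<Longrightarrow> (\<And>i. i < n \<Longrightarrow> t i \<le> t (Suc i)) \<Longrightarrow>
    indep_vars (\<lambda>_. borel) (\<lambda>i \<omega>. W (t (Suc i)) \<omega> - W (t i) \<omega>) {..<n}"
  using bm unfolding standard_brownian_motion_def by blast

context
  fixes \<sigma> h \<eta> c :: real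
  assumes h: "0 < h"
begin

lemma grid_incr_indep: "indep_vars (\<lambda>_. borel) (\<lambda>k. grid_incr W h n (a + k)) {..<m}"
  using bm_indep[of "\<lambda>k. real (a + k) * (h / 2 ^ n)" m] h
  unfolding grid_incr_def by (simp add: mult_right_mono divide_right_mono)

lemma grid_incr_distr: "distr M borel (grid_incr W h n k) = density lborel (normal_density 0 (sqrt (h / 2 ^ n)))"
proof -
  have "distributed M lborel (grid_incr W h n k) (normal_density 0 (sqrt (h / 2 ^ n)))"
  proof -
    have "real (Suc k) * (h / 2 ^ n) - real k * (h / 2 ^ n) = h / 2 ^ n"
      by (simp add: algebra_simps add_divide_distrib)
    moreover have "real k * (h / 2 ^ n) < real (Suc k) * (h / 2 ^ n)" using h by (intro mult_strict_right_mono) auto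
    ultimately show ?thesis using bm_normal[of "real k * (h / 2 ^ n)" "real (Suc k) * (h / 2 ^ n)"] h
      unfolding grid_incr_def[abs_def] by (simp only:) simp
  qed
  from distributed_distr_eq_density[OF this] show ?thesis by (metis distr_cong sets_lborel)
qed

lemma walk_event_sets:
  assumes "\<And>k. k < 2 ^ n \<Longrightarrow> a + k \<in> I"
  shows "{x \<in> space (PiM I (\<lambda>_. borel)). walk_event n \<sigma> \<eta> c (\<lambda>k. x (a + k))} \<in> sets (PiM I (\<lambda>_. borel))"
proof -
  have "(\<lambda>x :: nat \<Rightarrow> real. \<Sum>k<j. x (a + k)) \<in> borel_measurable (PiM I (\<lambda>_. borel))" if "j \<le> 2 ^ n" for j
  proof (rule borel_measurable_sum)
    fix k assume "k \<in> {..<j}"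
    then have "a + k \<in> I" using that assms by simp
    then show "(\<lambda>x :: nat \<Rightarrow> real. x (a + k)) \<in> borel_measurable (PiM I (\<lambda>_. borel))"
      by (rule measurable_component_singleton)
  qed
  then have [measurable]: "(\<lambda>x :: nat \<Rightarrow> real. \<Sum>k<j. x (a + k)) \<in> borel_measurable (PiM I (\<lambda>_. borel))" if "j \<in> {..2 ^ n}" for j
    using that by simp
  show ?thesis unfolding walk_event_def by measurable
qed

text \<open>Disjoint blocks of independent increments give independent cells; equal laws of the
  increments give every cell the same probability \<open>p\<close>.\<close>

lemma prob_dyadic_cells:
  "\<exists>p. \<forall>J. finite J \<longrightarrow> {\<omega> \<in> space M. \<forall>i\<in>J. dyadic_cell n \<sigma> h \<eta> c (\<lambda>t. W t \<omega>) i} \<in> events \<and>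
     prob {\<omega> \<in> space M. \<forall>i\<in>J. dyadic_cell n \<sigma> h \<eta> c (\<lambda>t. W t \<omega>) i} = p ^ card J"
proof -
  let ?N = "density lborel (normal_density 0 (sqrt (h / 2 ^ n)))"
  define P where "P = PiM {..<2 ^ n :: nat} (\<lambda>_. ?N)"
  define p where "p = measure P {x \<in> space (PiM {..<2 ^ n} (\<lambda>_. borel)). walk_event n \<sigma> \<eta> c x}"
  have X: "grid_incr W h n k \<in> borel_measurable M" for k
    unfolding grid_incr_def[abs_def] using h by (intro borel_measurable_diff bm_measurable) auto
  define K where "K i = {i * 2 ^ n ..< Suc i * 2 ^ n}" for i :: nat
  define Y where "Y i \<omega> = restrict (\<lambda>k. grid_incr W h n k \<omega>) (K i)" for i \<omega>
  define A where "A i = {x \<in> space (PiM (K i) (\<lambda>_. borel)). walk_event n \<sigma> \<eta> c (\<lambda>k. x (i * 2 ^ n + k))}" for i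
  have inK: "i * 2 ^ n + k \<in> K i" if "k < 2 ^ n" for i k using that by (simp add: K_def)
  have A: "A i \<in> sets (PiM (K i) (\<lambda>_. borel))" for i unfolding A_def by (intro walk_event_sets inK)
  have D: "dyadic_cell n \<sigma> h \<eta> c (\<lambda>t. W t \<omega>) i \<longleftrightarrow> walk_event n \<sigma> \<eta> c (\<lambda>k. grid_incr W h n (i * 2 ^ n + k) \<omega>)" for i \<omega>
    unfolding dyadic_cell_walk grid_incr_def ..
  have Y: "Y i -` A i \<inter> space M = {\<omega> \<in> space M. dyadic_cell n \<sigma> h \<eta> c (\<lambda>t. W t \<omega>) i}" for i
  proof -
    have "walk_event n \<sigma> \<eta> c (\<lambda>k. Y i \<omega> (i * 2 ^ n + k)) \<longleftrightarrow> dyadic_cell n \<sigma> h \<eta> c (\<lambda>t. W t \<omega>) i" for \<omega>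
      unfolding D by (rule walk_event_cong) (simp add: Y_def inK)
    moreover have "Y i \<omega> \<in> space (PiM (K i) (\<lambda>_. borel))" for \<omega> by (simp add: Y_def space_PiM)
    ultimately show ?thesis by (auto simp: A_def)
  qed
  have ev: "{\<omega> \<in> space M. dyadic_cell n \<sigma> h \<eta> c (\<lambda>t. W t \<omega>) i} \<in> events" for i
    unfolding Y[symmetric] Y_def[abs_def] by (rule measurable_sets[OF _ A]) (rule measurable_restrict, rule X)
  have single: "prob {\<omega> \<in> space M. dyadic_cell n \<sigma> h \<eta> c (\<lambda>t. W t \<omega>) i} = p" for i
  proof -
    let ?Z = "\<lambda>\<omega>. \<lambda>k\<in>{..<2 ^ n}. grid_incr W h n (i * 2 ^ n + k) \<omega>"
    let ?B = "{x \<in> space (PiM {..<2 ^ n} (\<lambda>_. borel)). walk_event n \<sigma> \<eta> c x}"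
    have "distr M (PiM {..<2 ^ n} (\<lambda>_. borel)) ?Z = PiM {..<2 ^ n} (\<lambda>k. distr M borel (grid_incr W h n (i * 2 ^ n + k)))"
      using indep_vars_iff_distr_eq_PiM[where I = "{..<2 ^ n :: nat}" and M' = "\<lambda>_. borel" and X = "\<lambda>k. grid_incr W h n (i * 2 ^ n + k)"]
        grid_incr_indep[of n "i * 2 ^ n" "2 ^ n"] X by (auto simp: lessThan_empty_iff)
    also have "\<dots> = P" unfolding P_def grid_incr_distr ..
    finally have Z: "distr M (PiM {..<2 ^ n} (\<lambda>_. borel)) ?Z = P" .
    have B: "?B \<in> sets (PiM {..<2 ^ n} (\<lambda>_. borel))" using walk_event_sets[of n 0 "{..<2 ^ n}"] by simp
    have "p = measure (distr M (PiM {..<2 ^ n} (\<lambda>_. borel)) ?Z) ?B" unfolding p_def Z ..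
    also have "\<dots> = prob (?Z -` ?B \<inter> space M)"
      using B X by (intro measure_distr measurable_restrict) auto
    also have "?Z -` ?B \<inter> space M = {\<omega> \<in> space M. dyadic_cell n \<sigma> h \<eta> c (\<lambda>t. W t \<omega>) i}"
    proof -
      have "walk_event n \<sigma> \<eta> c (?Z \<omega>) \<longleftrightarrow> dyadic_cell n \<sigma> h \<eta> c (\<lambda>t. W t \<omega>) i" for \<omega>
        unfolding D by (rule walk_event_cong) simp
      then show ?thesis by (auto simp: space_PiM)
    qed
    finally show ?thesis by simp
  qed
  have "{\<omega> \<in> space M. \<forall>i\<in>J. dyadic_cell n \<sigma> h \<eta> c (\<lambda>t. W t \<omega>) i} \<in> events \<and>
     prob {\<omega> \<in> space M. \<forall>i\<in>J. dyadic_cell n \<sigma> h \<eta> c (\<lambda>t. W t \<omega>) i} = p ^ card J" if J: "finite J" for J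
  proof (cases "J = {}")
    case True
    then show ?thesis by (simp add: prob_space)
  next
    case False
    obtain I where I: "J \<subseteq> {..<I}" using J finite_nat_iff_bounded by blast
    have "indep_vars (\<lambda>i. PiM (K i) (\<lambda>_. borel)) Y {..<I}"
      unfolding Y_def
    proof (rule indep_vars_restrict)
      show "indep_vars (\<lambda>_. borel) (grid_incr W h n) {..<I * 2 ^ n}"
        using grid_incr_indep[of n 0 "I * 2 ^ n"] by simp
      show "K i \<subseteq> {..<I * 2 ^ n}" if "i \<in> {..<I}" for i
      proof -
        have "Suc i * 2 ^ n \<le> I * 2 ^ n" using that by (intro mult_le_mono1) simp
        then show ?thesis unfolding K_def by (meson atLeastLessThan_iff lessThan_iff less_le_trans subsetI)
      qed
      show "disjoint_family_on K {..<I}"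
      proof -
        have "i = i'" if "x \<in> K i" "x \<in> K i'" for i i' x
        proof -
          have "x div 2 ^ n = i" if "x \<in> K i" for i
            using that by (auto simp: K_def intro!: div_nat_eqI simp: mult.commute)
          then show ?thesis using that by blast
        qed
        then show ?thesis by (auto simp: disjoint_family_on_def)
      qed
    qed
    from indep_varsD[OF this False J I, of A]
    have "prob (\<Inter>i\<in>J. Y i -` A i \<inter> space M) = (\<Prod>i\<in>J. prob (Y i -` A i \<inter> space M))" using A by simp
    then have "prob (\<Inter>i\<in>J. {\<omega> \<in> space M. dyadic_cell n \<sigma> h \<eta> c (\<lambda>t. W t \<omega>) i}) = p ^ card J"
      unfolding Y single by simp
    moreover have "(\<Inter>i\<in>J. {\<omega> \<in> space M. dyadic_cell n \<sigma> h \<eta> c (\<lambda>t. W t \<omega>) i})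
        = {\<omega> \<in> space M. \<forall>i\<in>J. dyadic_cell n \<sigma> h \<eta> c (\<lambda>t. W t \<omega>) i}" using False by auto
    moreover have "(\<Inter>i\<in>J. {\<omega> \<in> space M. dyadic_cell n \<sigma> h \<eta> c (\<lambda>t. W t \<omega>) i}) \<in> events"
      using J False ev by (intro sets.finite_INT) auto
    ultimately show ?thesis by simp
  qed
  then show ?thesis by blast
qed

text \<open>The dyadic events decrease under refinement, so the product formula passes to the limit
  by continuity from above.\<close>

lemma prob_steady_cells:
  assumes J: "finite J"
  shows "{\<omega> \<in> space M. \<forall>i\<in>J. steady_cell \<sigma> h \<eta> c (\<lambda>t. W t \<omega>) i} \<in> events" (is "?S J \<in> _")
    and "prob {\<omega> \<in> space M. \<forall>i\<in>J. steady_cell \<sigma> h \<eta> c (\<lambda>t. W t \<omega>) i} =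
      prob {\<omega> \<in> space M. steady_cell \<sigma> h \<eta> c (\<lambda>t. W t \<omega>) 0} ^ card J"
proof -
  let ?D = "\<lambda>J n. {\<omega> \<in> space M. \<forall>i\<in>J. dyadic_cell n \<sigma> h \<eta> c (\<lambda>t. W t \<omega>) i}"
  have "\<exists>p. \<forall>n J. finite J \<longrightarrow> ?D J n \<in> events \<and> prob (?D J n) = p n ^ card J"
    by (rule choice) (use prob_dyadic_cells in blast)
  then obtain p where D: "\<And>n J. finite J \<Longrightarrow> ?D J n \<in> events"
    and p: "\<And>n J. finite J \<Longrightarrow> prob (?D J n) = p n ^ card J" by blast
  have S: "?S J = (\<Inter>n. ?D J n)" for J
    using steady_cell_iff_dyadic[OF h bm_continuous] by auto
  have "decseq (?D J)" for J
    unfolding decseq_def using dyadic_cell_antimono by blast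
  then have lim: "(\<lambda>n. prob (?D J n)) \<longlonglongrightarrow> prob (?S J)" if "finite J" for J
    unfolding S using D[OF that] by (intro finite_Lim_measure_decseq) auto
  show "?S J \<in> events" unfolding S using D[OF J] by (intro sets.countable_INT) auto
  have "(\<lambda>n. p n) \<longlonglongrightarrow> prob (?S {0})" using lim[of "{0}"] p[of "{0}"] by simp
  then have "(\<lambda>n. p n ^ card J) \<longlonglongrightarrow> prob (?S {0}) ^ card J" by (intro tendsto_intros)
  moreover have "(\<lambda>n. p n ^ card J) \<longlonglongrightarrow> prob (?S J)" using lim[OF J] p[OF J] by simp
  ultimately show "prob (?S J) = prob {\<omega> \<in> space M. steady_cell \<sigma> h \<eta> c (\<lambda>t. W t \<omega>) 0} ^ card J"
    using LIMSEQ_unique by force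
qed

text \<open>Blocks of \<open>J\<close> cells are independent events of one positive probability. The
  zero-one law leaves finitely many or infinitely many of them, and the former would give the limit
  superior probability zero.\<close>

lemma AE_infinite_steady_blocks:
  assumes pos: "0 < prob {\<omega> \<in> space M. steady_cell \<sigma> h \<eta> c (\<lambda>t. W t \<omega>) 0}" and J: "0 < J"
  shows "AE \<omega> in M. infinite {k. \<forall>i\<in>{k * J..<Suc k * J}. steady_cell \<sigma> h \<eta> c (\<lambda>t. W t \<omega>) i}"
proof -
  let ?p = "prob {\<omega> \<in> space M. steady_cell \<sigma> h \<eta> c (\<lambda>t. W t \<omega>) 0}"
  let ?P = "\<lambda>k \<omega>. \<forall>i\<in>{k * J..<Suc k * J}. steady_cell \<sigma> h \<eta> c (\<lambda>t. W t \<omega>) i"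
  let ?F = "\<lambda>k. {\<omega> \<in> space M. ?P k \<omega>}"
  have F: "?F k \<in> events" "prob (?F k) = ?p ^ J" for k
    using prob_steady_cells[of "{k * J..<Suc k * J}"] by auto
  have "indep_events ?F UNIV"
    unfolding indep_events_def
  proof (intro conjI allI impI)
    fix L :: "nat set" assume L: "L \<noteq> {}" "finite L"
    have disj: "disjoint_family_on (\<lambda>k. {k * J..<Suc k * J}) L"
    proof -
      have "x div J = k" if "x \<in> {k * J..<Suc k * J}" for x k
        using that by (auto intro!: div_nat_eqI simp: mult.commute)
      then show ?thesis unfolding disjoint_family_on_def by blast
    qed
    have "(\<Inter>k\<in>L. ?F k) = {\<omega> \<in> space M. \<forall>i\<in>(\<Union>k\<in>L. {k * J..<Suc k * J}). steady_cell \<sigma> h \<eta> c (\<lambda>t. W t \<omega>) i}"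
      using L by auto
    moreover have "card (\<Union>k\<in>L. {k * J..<Suc k * J}) = card L * J"
      using card_UN_disjoint'[OF disj] L by simp
    ultimately have "prob (\<Inter>k\<in>L. ?F k) = ?p ^ (card L * J)"
      using prob_steady_cells(2)[of "\<Union>k\<in>L. {k * J..<Suc k * J}"] L by simp
    then show "prob (\<Inter>k\<in>L. ?F k) = (\<Prod>k\<in>L. prob (?F k))"
      unfolding F by (simp add: mult.commute power_mult)
  qed (use F in auto)
  from borel_0_1_law_AE[OF this] show ?thesis
  proof
    assume fin: "AE \<omega> in M. finite {k. ?P k \<omega>}"
    let ?U = "\<lambda>n. \<Union>k\<in>{n..}. ?F k"
    have U: "?U n \<in> events" for n using F by auto
    have "(\<lambda>n. prob (?U n)) \<longlonglongrightarrow> prob (\<Inter>n. ?U n)"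
    proof (rule finite_Lim_measure_decseq)
      show "decseq ?U" unfolding decseq_def by (intro allI impI UN_mono) auto
    qed (use U in auto)
    \<comment> \<open>Each union contains its first event, so the decreasing intersection keeps at
      least this probability.\<close>
    moreover have "?p ^ J \<le> prob (?U n)" for n
      unfolding F(2)[of n, symmetric] using U by (intro finite_measure_mono) auto
    ultimately have "?p ^ J \<le> prob (\<Inter>n. ?U n)" by (intro LIMSEQ_le_const) auto
    moreover have "prob (\<Inter>n. ?U n) = 0"
    proof -
      have "AE \<omega> in M. \<omega> \<notin> (\<Inter>n. ?U n)"
        using fin
      proof eventually_elim
        case (elim \<omega>)
        then obtain n where "\<forall>k\<in>{k. ?P k \<omega>}. k < n" using finite_nat_set_iff_bounded by blast
        then have "\<omega> \<notin> ?U n" using not_less by blast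
        then show ?case by blast
      qed
      then show ?thesis using U by (subst prob_eq_0) auto
    qed
    ultimately show ?thesis using zero_less_power[OF pos, of J] by linarith
  qed
qed

end

end

end

section \<open>Positive probability of a steady cell\<close>

context prob_space
begin

text \<open>The density is symmetric and there is no atom at zero.\<close>

lemma normal_prob_pos:
  assumes X: "distributed M lborel X (normal_density 0 s)" and s: "0 < s"
  shows "prob {\<omega> \<in> space M. 0 < X \<omega>} = 1 / 2"
proof -
  have Xm [measurable]: "X \<in> borel_measurable M" using distributed_measurable[OF X] by simp
  have Y: "distributed M lborel (\<lambda>\<omega>. - X \<omega>) (normal_density 0 s)"
    using normal_density_affine[OF X s, of "-1" 0] by simp
  have "distr M lborel X = distr M lborel (\<lambda>\<omega>. - X \<omega>)"
    using distributed_distr_eq_density[OF X] distributed_distr_eq_density[OF Y] by simp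
  then have "measure (distr M lborel X) {0<..} = measure (distr M lborel (\<lambda>\<omega>. - X \<omega>)) {0<..}" by simp
  then have sym: "prob {\<omega> \<in> space M. 0 < X \<omega>} = prob {\<omega> \<in> space M. X \<omega> < 0}"
    by (simp add: measure_distr vimage_def Int_def conj_commute)
  have "AE x in lborel. x \<noteq> (0::real)" by (rule AE_lborel_singleton)
  then have "AE \<omega> in M. X \<omega> \<noteq> 0"
    by (subst distributed_AE2[OF X]) (auto elim: eventually_mono)
  then have "AE \<omega> in M. \<omega> \<in> {\<omega> \<in> space M. 0 < X \<omega>} \<union> {\<omega> \<in> space M. X \<omega> < 0}"
    using AE_space by eventually_elim auto
  then have "prob ({\<omega> \<in> space M. 0 < X \<omega>} \<union> {\<omega> \<in> space M. X \<omega> < 0}) = 1"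
    by (subst prob_eq_1) auto
  moreover have "prob ({\<omega> \<in> space M. 0 < X \<omega>} \<union> {\<omega> \<in> space M. X \<omega> < 0})
      = prob {\<omega> \<in> space M. 0 < X \<omega>} + prob {\<omega> \<in> space M. X \<omega> < 0}"
    by (intro finite_measure_Union) auto
  ultimately show ?thesis using sym by simp
qed

text \<open>First \<open>h\<close> is taken so small that the path stays within
  \<open>\<eta>\<close> on the cell with probability above \<open>3/4\<close>; then \<open>c\<close>
  so small that the gain reaches \<open>c\<close> with probability above \<open>1/4\<close>. Two
  such events must overlap.\<close>

lemma steady_cell_prob_pos:
  assumes bm: "standard_brownian_motion W" and \<sigma>: "\<sigma> \<in> {1, -1}" and \<eta>: "0 < \<eta>"
  obtains h c where "0 < h" "0 < c" "0 < prob {\<omega> \<in> space M. steady_cell \<sigma> h \<eta> c (\<lambda>t. W t \<omega>) 0}"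
proof -
  note W0 = bm_0[OF bm] and cont = bm_continuous[OF bm] and Wm = bm_measurable[OF bm]
  define D where "D m = {\<omega> \<in> space M. \<forall>r\<in>{0..1 / real (Suc m)}. \<bar>W r \<omega>\<bar> \<le> \<eta>}" for m
  \<comment> \<open>With the gain bound \<open>- \<eta>\<close> the second clause of
    \<open>steady_cell\<close> is automatic, so measurability comes from the cell lemma.\<close>
  have D_cell: "D m = {\<omega> \<in> space M. \<forall>i\<in>{0}. steady_cell \<sigma> (1 / real (Suc m)) \<eta> (- \<eta>) (\<lambda>t. W t \<omega>) i}" for m
  proof -
    have "- \<eta> \<le> \<sigma> * W (1 / real (Suc m)) \<omega>" if "\<forall>r\<in>{0..1 / real (Suc m)}. \<bar>W r \<omega>\<bar> \<le> \<eta>" for \<omega>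
      using that[rule_format, of "1 / real (Suc m)"] \<sigma> by auto
    then show ?thesis by (auto simp: D_def steady_cell_def W0 simp del: of_nat_Suc)
  qed
  have D: "D m \<in> events" for m
    unfolding D_cell by (rule prob_steady_cells(1)[OF bm]) auto
  have "incseq D"
  proof (rule incseq_SucI, rule subsetI)
    fix m \<omega> assume "\<omega> \<in> D m"
    moreover have "1 / real (Suc (Suc m)) \<le> 1 / real (Suc m)" by (simp add: field_simps)
    ultimately show "\<omega> \<in> D (Suc m)" unfolding D_def by force
  qed
  moreover have "(\<Union>m. D m) = space M"
  proof (rule antisym)
    show "space M \<subseteq> (\<Union>m. D m)"
    proof
      fix \<omega> assume \<omega>: "\<omega> \<in> space M"
      obtain d where d: "d > 0" "\<And>r. r \<in> {0..} \<Longrightarrow> dist r 0 < d \<Longrightarrow> dist (W r \<omega>) (W 0 \<omega>) < \<eta>"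
        using cont[OF \<omega>] \<eta> unfolding continuous_on_iff by (metis atLeast_iff order_refl)
      obtain m where m: "1 / real (Suc m) < d" using d(1) by (metis nat_approx_posE)
      have "\<bar>W r \<omega>\<bar> \<le> \<eta>" if "r \<in> {0..1 / real (Suc m)}" for r
        using d(2)[of r] that m W0[OF \<omega>] by (auto simp: dist_real_def)
      then show "\<omega> \<in> (\<Union>m. D m)" using \<omega> unfolding D_def by blast
    qed
  qed (auto simp: D_def)
  ultimately have "(\<lambda>m. prob (D m)) \<longlonglongrightarrow> 1"
    using finite_Lim_measure_incseq[of D] D by (auto simp: prob_space)
  then have "\<forall>\<^sub>F m in sequentially. 3 / 4 < prob (D m)" by (rule order_tendstoD) simp
  then obtain m where m: "3 / 4 < prob (D m)" by (auto simp: eventually_sequentially)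
  define h where "h = 1 / real (Suc m)"
  have h: "0 < h" by (simp add: h_def)
  note [measurable] = Wm[OF less_imp_le[OF h]]
  have "distributed M lborel (\<lambda>\<omega>. W h \<omega> - W 0 \<omega>) (normal_density 0 (sqrt (h - 0)))"
    by (rule bm_normal[OF bm]) (use h in auto)
  from normal_density_affine[OF this, of \<sigma> 0]
  have "distributed M lborel (\<lambda>\<omega>. \<sigma> * (W h \<omega> - W 0 \<omega>)) (normal_density 0 (sqrt h))"
    using \<sigma> h by auto
  from normal_prob_pos[OF this] have "prob {\<omega> \<in> space M. 0 < \<sigma> * (W h \<omega> - W 0 \<omega>)} = 1 / 2" using h by simp
  moreover have "{\<omega> \<in> space M. 0 < \<sigma> * (W h \<omega> - W 0 \<omega>)} = {\<omega> \<in> space M. 0 < \<sigma> * W h \<omega>}" using W0 by auto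
  ultimately have half: "prob {\<omega> \<in> space M. 0 < \<sigma> * W h \<omega>} = 1 / 2" by simp
  define E where "E k = {\<omega> \<in> space M. 1 / real (Suc k) \<le> \<sigma> * W h \<omega>}" for k
  have E [measurable]: "E k \<in> events" for k unfolding E_def by measurable
  have "incseq E"
  proof (rule incseq_SucI, rule subsetI)
    fix k \<omega> assume "\<omega> \<in> E k"
    moreover have "1 / real (Suc (Suc k)) \<le> 1 / real (Suc k)" by (simp add: field_simps)
    ultimately show "\<omega> \<in> E (Suc k)" unfolding E_def by force
  qed
  moreover have "(\<Union>k. E k) = {\<omega> \<in> space M. 0 < \<sigma> * W h \<omega>}"
  proof (intro equalityI subsetI)
    fix \<omega> assume "\<omega> \<in> (\<Union>k. E k)"
    then obtain k where "\<omega> \<in> space M" "1 / real (Suc k) \<le> \<sigma> * W h \<omega>" by (auto simp: E_def)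
    moreover have "0 < 1 / real (Suc k)" by simp
    ultimately show "\<omega> \<in> {\<omega> \<in> space M. 0 < \<sigma> * W h \<omega>}" using less_le_trans by blast
  next
    fix \<omega> assume a: "\<omega> \<in> {\<omega> \<in> space M. 0 < \<sigma> * W h \<omega>}"
    then obtain k where "1 / real (Suc k) < \<sigma> * W h \<omega>" using nat_approx_posE by blast
    then show "\<omega> \<in> (\<Union>k. E k)" using a by (auto simp: E_def intro: less_imp_le)
  qed
  moreover have "range E \<subseteq> events" using E by blast
  ultimately have "(\<lambda>k. prob (E k)) \<longlonglongrightarrow> 1 / 2"
    using finite_Lim_measure_incseq[of E] half by simp
  then have "\<forall>\<^sub>F k in sequentially. 1 / 4 < prob (E k)" by (rule order_tendstoD) simp
  then obtain k where k: "1 / 4 < prob (E k)" by (auto simp: eventually_sequentially)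
  have "prob (D m \<union> E k) = prob (D m) + prob (E k) - prob (D m \<inter> E k)"
    using D E by (intro finite_measure_Union' [THEN trans]) (auto simp: measure_Diff finite_measure_Diff' Int_commute)
  moreover have "prob (D m \<union> E k) \<le> 1" by simp
  ultimately have pos: "0 < prob (D m \<inter> E k)" using m k by linarith
  define c where "c = 1 / real (Suc k)"
  have "D m \<inter> E k \<subseteq> {\<omega> \<in> space M. steady_cell \<sigma> h \<eta> c (\<lambda>t. W t \<omega>) 0}"
    unfolding D_def E_def h_def[symmetric] c_def[symmetric] steady_cell_def by (auto simp: W0)
  then have "prob (D m \<inter> E k) \<le> prob {\<omega> \<in> space M. steady_cell \<sigma> h \<eta> c (\<lambda>t. W t \<omega>) 0}"
    using prob_steady_cells(1)[OF bm h, of "{0}" \<sigma> \<eta> c] by (intro finite_measure_mono) auto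
  with pos have "0 < prob {\<omega> \<in> space M. steady_cell \<sigma> h \<eta> c (\<lambda>t. W t \<omega>) 0}" by linarith
  moreover have "0 < c" by (simp add: c_def)
  ultimately show thesis using that h by blast
qed

end

text \<open>The grid values increase in the direction \<open>\<sigma>\<close> and within a cell the path stays within
  distance \<open>\<eta>\<close> of its value at the left grid point.\<close>

lemma steady_cells_block:
  assumes h: "0 < h" and c: "0 < c" and \<sigma>: "\<sigma> \<in> {1, -1}" and k: "k \<le> k'"
    and cells: "\<And>i. i \<in> {k..<k'} \<Longrightarrow> steady_cell \<sigma> h \<eta> c w i"
  shows "real (k' - k) * c \<le> \<sigma> * (w (real k' * h) - w (real k * h))"
    and "\<lbrakk>0 \<le> \<eta>; real k * h \<le> u; u \<le> v; v \<le> real k' * h\<rbrakk> \<Longrightarrow> - (2 * \<eta>) \<le> \<sigma> * (w v - w u)"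
proof -
  have step: "c \<le> \<sigma> * (w (real (Suc i) * h) - w (real i * h))" if "i \<in> {k..<k'}" for i
  proof -
    have "real (Suc i) * h = real i * h + h" by (simp add: algebra_simps)
    then show ?thesis using cells[OF that] unfolding steady_cell_def by metis
  qed
  have grid: "real (j - i) * c \<le> \<sigma> * (w (real j * h) - w (real i * h))" if "k \<le> i" "i \<le> j" "j \<le> k'" for i j
    using that(2,3)
  proof (induction j rule: dec_induct)
    case (step j)
    have "real (Suc j - i) * c = real (j - i) * c + c"
      using step by (simp add: Suc_diff_le algebra_simps)
    moreover have "c \<le> \<sigma> * (w (real (Suc j) * h) - w (real j * h))"
      using step that(1) by (intro \<open>\<And>i. i \<in> {k..<k'} \<Longrightarrow> c \<le> \<sigma> * (w (real (Suc i) * h) - w (real i * h))\<close>) auto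
    ultimately show ?case using step.IH step.prems by (simp only: right_diff_distrib) linarith
  qed simp
  show "real (k' - k) * c \<le> \<sigma> * (w (real k' * h) - w (real k * h))" using grid[of k k'] k by simp
  assume \<eta>: "0 \<le> \<eta>" and uv: "real k * h \<le> u" "u \<le> v" "v \<le> real k' * h"
  have near: "\<exists>i\<in>{k..k'}. real i * h \<le> x \<and> x < real (Suc i) * h \<and> \<bar>w x - w (real i * h)\<bar> \<le> \<eta>"
    if x: "real k * h \<le> x" "x \<le> real k' * h" for x
  proof -
    define i where "i = nat \<lfloor>x / h\<rfloor>"
    have "0 \<le> real k * h" using h by simp
    with x(1) have "0 \<le> x" by linarith
    then have "real i = of_int \<lfloor>x / h\<rfloor>" using h by (simp add: i_def)
    then have "real i \<le> x / h" "x / h < real i + 1" by linarith+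
    then have i: "real i * h \<le> x" "x < real (Suc i) * h" using h by (simp_all add: field_simps)
    have "real k * h < real (Suc i) * h" "real i * h \<le> real k' * h" using i x by linarith+
    then have ki: "k \<le> i" "i \<le> k'" using h by (simp_all only: mult_less_cancel_right_pos mult_le_cancel_right_pos of_nat_less_iff of_nat_le_iff)
    have "\<bar>w x - w (real i * h)\<bar> \<le> \<eta>"
    proof (cases "i = k'")
      \<comment> \<open>The right end of the block belongs to no cell of the block, but there
        \<open>x\<close> is itself the grid point.\<close>
      case True
      then show ?thesis using i(1) x(2) \<eta> by simp
    next
      case False
      then have "steady_cell \<sigma> h \<eta> c w i" using ki by (intro cells) auto
      moreover have "x - real i * h \<in> {0..h}" using i by (simp add: algebra_simps)
      ultimately have "\<bar>w (real i * h + (x - real i * h)) - w (real i * h)\<bar> \<le> \<eta>"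
        unfolding steady_cell_def by blast
      then show ?thesis by simp
    qed
    then show ?thesis using i ki by auto
  qed
  obtain i where i: "i \<in> {k..k'}" "real i * h \<le> u" "\<bar>w u - w (real i * h)\<bar> \<le> \<eta>"
    using near[of u] uv by auto
  obtain j where j: "j \<in> {k..k'}" "v < real (Suc j) * h" "\<bar>w v - w (real j * h)\<bar> \<le> \<eta>"
    using near[of v] uv by auto
  have "real i * h < real (Suc j) * h" using i j uv by linarith
  then have "i \<le> j" using h by (simp only: mult_less_cancel_right_pos of_nat_less_iff less_Suc_eq_le)
  then have "real (j - i) * c \<le> \<sigma> * (w (real j * h) - w (real i * h))" using i j by (intro grid) auto
  moreover have "0 \<le> real (j - i) * c" using c by simp
  ultimately have "0 \<le> \<sigma> * (w (real j * h) - w (real i * h))" by linarith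
  \<comment> \<open>The grid values do not fall; each end contributes an error of at most
    \<open>\<eta>\<close>.\<close>
  then show "- (2 * \<eta>) \<le> \<sigma> * (w v - w u)" using \<sigma> i(3) j(3) by auto
qed

section \<open>The coalescence times\<close>

lemma limsup_modification_unit:
  assumes u: "\<And>s t. s \<le> t \<Longrightarrow> u s t \<in> {0..1}" and st: "s \<le> t"
  shows "limsup_modification u s t \<in> {0..1}"
proof (cases "s < t")
  case True
  let ?s = "\<lambda>n::nat. (of_int \<lfloor>real n * s\<rfloor> + 1) / real n" and ?t = "\<lambda>n::nat. (of_int \<lfloor>real n * t\<rfloor> - 1) / real n"
  let ?x = "\<lambda>n. ereal (u (?s n) (?t n))"
  \<comment> \<open>The gap \<open>3\<close> absorbs the shifts \<open>+1\<close> and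
    \<open>-1\<close> and the rounding, so that eventually the indices are in order.\<close>
  obtain n0 :: nat where n0: "3 / (t - s) < real n0" using reals_Archimedean2 by blast
  have ev: "\<forall>\<^sub>F n in sequentially. 0 \<le> ?x n \<and> ?x n \<le> 1"
  proof (rule eventually_sequentiallyI)
    fix n assume "n0 \<le> n"
    then have "3 / (t - s) < real n" using n0 by (meson less_le_trans of_nat_le_iff)
    then have "3 < real n * (t - s)" using True by (simp add: pos_divide_less_eq)
    then have "real n * s + 3 < real n * t" by (simp add: algebra_simps)
    then have "of_int \<lfloor>real n * s\<rfloor> + 1 \<le> (of_int \<lfloor>real n * t\<rfloor> - 1 :: real)" by linarith
    then have "?s n \<le> ?t n" by (intro divide_right_mono) auto
    from u[OF this] show "0 \<le> ?x n \<and> ?x n \<le> 1" by simp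
  qed
  have "0 \<le> limsup ?x" by (rule le_Limsup) (use ev in \<open>auto elim: eventually_mono\<close>)
  moreover have "limsup ?x \<le> 1" by (rule Limsup_bounded) (use ev in \<open>auto elim: eventually_mono\<close>)
  ultimately have "real_of_ereal (limsup ?x) \<in> {0..1}" by (cases "limsup ?x") auto
  then show ?thesis using True by (simp add: limsup_modification_def)
next
  case False
  then show ?thesis using u[OF st] by (simp add: limsup_modification_def)
qed

lemma (in flow_path) good_run_iff:
  "good_run l N \<sigma> w n \<longleftrightarrow> (\<forall>i\<in>{n..<n + N}. l / 2 \<le> \<sigma> * (w (rt (Suc i)) - w (rt i)))"
  unfolding good_run_def rt_def ..

text \<open>The infimum is a time \<open>rt (m + N)\<close> with \<open>m \<ge> k\<close> preceded
  by \<open>N\<close> good steps: it is at least \<open>rt k\<close>, which tends to infinity, and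
  all mass has coalesced by then.\<close>

lemma (in flow_path) good_time_flow:
  assumes \<sigma>: "\<sigma> \<in> {1, -1}" and N: "2 * pi \<le> real N * (l / 2)"
    and inf: "\<And>k. \<exists>n\<ge>k. good_run l N \<sigma> w n"
  shows "(\<lambda>k. good_time l N \<sigma> k w) \<longlonglongrightarrow> \<infinity>"
    and "good_time l N \<sigma> k w < \<infinity>"
    and "z \<in> sphere 0 1 \<Longrightarrow> flow_kernel l up um w 0 (enn2real (good_time l N \<sigma> k w)) z = return circle (target l \<sigma>)"
proof -
  have att: "\<exists>m\<ge>k. good_run l N \<sigma> w m \<and> good_time l N \<sigma> k w = ennreal (rt (m + N))" for k
  proof -
    obtain n where "k \<le> n" "good_run l N \<sigma> w n" using inf by blast
    then obtain m where "k \<le> m" "good_run l N \<sigma> w m" "good_time l N \<sigma> k w = e2ennreal (rho_iter l w 0 (m + N))"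
      by (rule good_time_attained)
    then show ?thesis unfolding rho_iter_rt by (auto simp: ennreal_def)
  qed
  show "good_time l N \<sigma> k w < \<infinity>" using att[of k] by auto
  show "flow_kernel l up um w 0 (enn2real (good_time l N \<sigma> k w)) z = return circle (target l \<sigma>)"
    if "z \<in> sphere 0 1"
  proof -
    obtain m where m: "good_run l N \<sigma> w m" "good_time l N \<sigma> k w = ennreal (rt (m + N))" using att by blast
    then show ?thesis using flow_kernel_target[OF \<sigma> N _ that, of m] rt_nonneg by (simp add: good_run_iff)
  qed
  have "(\<lambda>k. ennreal (rt k)) \<longlonglongrightarrow> \<infinity>"
    using rt_at_top rt_nonneg by (subst infinity_ennreal_def, subst ennreal_tendsto_top_eq_at_top) auto
  moreover have le: "ennreal (rt k) \<le> good_time l N \<sigma> k w" for k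
  proof -
    obtain m where "k \<le> m" "good_time l N \<sigma> k w = ennreal (rt (m + N))" using att by blast
    then show ?thesis using rt_mono[of k "m + N"] by (simp add: ennreal_leI)
  qed
  ultimately show "(\<lambda>k. good_time l N \<sigma> k w) \<longlonglongrightarrow> \<infinity>"
  proof -
    assume lim: "(\<lambda>k. ennreal (rt k)) \<longlonglongrightarrow> \<infinity>"
    show ?thesis
    proof (rule tendsto_sandwich)
      show "\<forall>\<^sub>F k in sequentially. ennreal (rt k) \<le> good_time l N \<sigma> k w" using le by (rule always_eventually[OF allI])
      show "\<forall>\<^sub>F k in sequentially. good_time l N \<sigma> k w \<le> \<infinity>" by simp
    qed (rule lim, rule tendsto_const)
  qed
qed

context prob_space
begin

lemma AE_steady_rises:
  assumes bm: "standard_brownian_motion W" and \<sigma>: "\<sigma> \<in> {1, -1}" and l: "0 < l"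
  shows "AE \<omega> in M. \<forall>x\<ge>0. \<exists>a\<ge>x. \<exists>b\<ge>a. real (Suc N) * l \<le> \<sigma> * (W b \<omega> - W a \<omega>) \<and>
    (\<forall>u v. a \<le> u \<longrightarrow> u \<le> v \<longrightarrow> v \<le> b \<longrightarrow> - (l / 2) \<le> \<sigma> * (W v \<omega> - W u \<omega>))"
proof -
  \<comment> \<open>Two errors of \<open>l / 4\<close> make up the admissible fall
    \<open>l / 2\<close>.\<close>
  have \<eta>: "0 < l / 4" using l by simp
  obtain h c where h: "0 < h" and c: "0 < c"
    and pos: "0 < prob {\<omega> \<in> space M. steady_cell \<sigma> h (l / 4) c (\<lambda>t. W t \<omega>) 0}"
    using steady_cell_prob_pos[OF bm \<sigma> \<eta>] .
  \<comment> \<open>A block of \<open>J\<close> cells, each with gain at least \<open>c\<close>,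
    rises by at least \<open>(N + 1) * l\<close>.\<close>
  obtain J :: nat where "real (Suc N) * l / c < real J" using reals_Archimedean2 by blast
  then have Jc: "real (Suc N) * l \<le> real J * c" using c by (simp add: field_simps)
  moreover have "0 < real (Suc N) * l" using l by simp
  ultimately have J: "0 < J" by (cases J) auto
  from AE_infinite_steady_blocks[OF bm h pos J] show ?thesis
  proof eventually_elim
    case (elim \<omega>)
    show ?case
    proof (intro allI impI)
      fix x :: real assume "0 \<le> x"
      obtain k0 :: nat where "x / h < real k0" using reals_Archimedean2 by blast
      then have k0: "x \<le> real k0 * h" using h by (simp add: field_simps)
      obtain k where k: "k0 \<le> k" "\<forall>i\<in>{k * J..<Suc k * J}. steady_cell \<sigma> h (l / 4) c (\<lambda>t. W t \<omega>) i"
        using elim unfolding infinite_nat_iff_unbounded_le by blast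
      let ?a = "real (k * J) * h" and ?b = "real (Suc k * J) * h"
      have le: "k * J \<le> Suc k * J" by simp
      have "k0 * 1 \<le> k * J" using k J by (intro mult_le_mono) auto
      then have "real k0 \<le> real (k * J)" by (simp only: of_nat_le_iff mult_1_right)
      then have "real k0 * h \<le> ?a" using h by (intro mult_right_mono) auto
      then have "x \<le> ?a" using k0 by linarith
      moreover have "?a \<le> ?b" using h by (intro mult_right_mono) auto
      moreover have "real (Suc N) * l \<le> \<sigma> * (W ?b \<omega> - W ?a \<omega>)"
        using steady_cells_block(1)[OF h c \<sigma> le, of "l / 4" "\<lambda>t. W t \<omega>"] k(2) Jc by simp
      moreover have "- (l / 2) \<le> \<sigma> * (W v \<omega> - W u \<omega>)" if "?a \<le> u" "u \<le> v" "v \<le> ?b" for u v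
        using steady_cells_block(2)[OF h c \<sigma> le, of "l / 4" "\<lambda>t. W t \<omega>" u v] k(2) that l by simp
      ultimately show "\<exists>a\<ge>x. \<exists>b\<ge>a. real (Suc N) * l \<le> \<sigma> * (W b \<omega> - W a \<omega>) \<and>
          (\<forall>u v. a \<le> u \<longrightarrow> u \<le> v \<longrightarrow> v \<le> b \<longrightarrow> - (l / 2) \<le> \<sigma> * (W v \<omega> - W u \<omega>))"
        by blast
    qed
  qed
qed

text \<open>The sign \<open>\<sigma>\<close> lets one argument serve both targets. Adaptedness and
  monotonicity hold at every sample point; steady rises are needed only for the almost sure
  part.\<close>

lemma coalescence_times:
  assumes bm: "standard_brownian_motion W" and \<sigma>: "\<sigma> \<in> {1, -1}" and l: "0 < l" "l \<le> pi"
    and Up: "\<And>s t \<omega>. s \<le> t \<Longrightarrow> \<omega> \<in> space M \<Longrightarrow> Up s t \<omega> \<in> {0..1}"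
    and Um: "\<And>s t \<omega>. s \<le> t \<Longrightarrow> \<omega> \<in> space M \<Longrightarrow> Um s t \<omega> \<in> {0..1}"
  shows "\<exists>S :: nat \<Rightarrow> 'a \<Rightarrow> ennreal.
            (\<forall>k\<ge>1. stopping_time (\<lambda>t. FW (space M) W 0 (enn2ereal t)) (S k)) \<and>
            (\<forall>\<omega>\<in>space M. mono_on {1..} (\<lambda>k. S k \<omega>)) \<and>
            (AE \<omega> in M. ((\<lambda>k. S k \<omega>) \<longlonglongrightarrow> \<infinity>) \<and>
               (\<forall>k\<ge>1. S k \<omega> < \<infinity> \<and>
                  (\<forall>z\<in>sphere 0 1.
                     random_flow l Up Um W \<omega> 0 (enn2real (S k \<omega>)) z = return circle (target l \<sigma>))))"
proof -
  obtain N :: nat where "4 * pi / l < real N" using reals_Archimedean2 by blast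
  then have N: "2 * pi \<le> real N * (l / 2)" using l by (simp add: field_simps)
  define S where "S k \<omega> = good_time l N \<sigma> k (\<lambda>t. W t \<omega>)" for k \<omega>
  have "stopping_time (\<lambda>t. FW (space M) W 0 (enn2ereal t)) (S k)" for k
    unfolding S_def[abs_def] using l(1) bm_0[OF bm] bm_continuous[OF bm] by (rule stopping_time_good_time)
  moreover have "mono_on {1..} (\<lambda>k. S k \<omega>)" for \<omega>
    unfolding S_def by (intro mono_onI good_time_mono)
  moreover have "AE \<omega> in M. ((\<lambda>k. S k \<omega>) \<longlonglongrightarrow> \<infinity>) \<and> (\<forall>k\<ge>1. S k \<omega> < \<infinity> \<and> (\<forall>z\<in>sphere 0 1.
      random_flow l Up Um W \<omega> 0 (enn2real (S k \<omega>)) z = return circle (target l \<sigma>)))"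
    using AE_steady_rises[OF bm \<sigma> l(1), of N] AE_space
  proof eventually_elim
    case (elim \<omega>)
    let ?w = "\<lambda>t. W t \<omega>"
    let ?up = "limsup_modification (\<lambda>s t. Up s t \<omega>)" and ?um = "limsup_modification (\<lambda>s t. Um s t \<omega>)"
    have rises: "\<exists>a\<ge>x. \<exists>b\<ge>a. real (Suc N) * l \<le> \<sigma> * (W b \<omega> - W a \<omega>) \<and>
      (\<forall>u v. a \<le> u \<longrightarrow> u \<le> v \<longrightarrow> v \<le> b \<longrightarrow> - (l / 2) \<le> \<sigma> * (W v \<omega> - W u \<omega>))" if "0 \<le> x" for x
      using elim(1) that by blast
    interpret flow_path l ?w ?up ?um
    proof
      show "continuous_on {0..} ?w" using bm_continuous[OF bm elim(2)] .
      show "?up s t \<in> {0..1}" if "s \<le> t" for s t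
        using that by (intro limsup_modification_unit Up elim(2))
      show "?um s t \<in> {0..1}" if "s \<le> t" for s t
        using that by (intro limsup_modification_unit Um elim(2))
      \<comment> \<open>The same late rises that create good runs keep the whole chain
        finite.\<close>
      show "\<exists>t. oscillates l ?w s t" if s: "0 \<le> s" for s
      proof -
        obtain a b where ab: "s \<le> a" "a \<le> b" "real (Suc N) * l \<le> \<sigma> * (W b \<omega> - W a \<omega>)"
          using rises[OF s] by blast
        have "0 \<le> real N * l" using l by simp
        then have "l \<le> \<sigma> * (W b \<omega> - W a \<omega>)" using ab(3) by (simp add: algebra_simps)
        then have "l \<le> W b \<omega> - W a \<omega> \<or> l \<le> W a \<omega> - W b \<omega>" using \<sigma> by auto
        moreover have "a \<in> {s..b}" "b \<in> {s..b}" using ab by auto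
        ultimately show ?thesis unfolding oscillates_def by blast
      qed
    qed (use l in auto)
    have "\<exists>n\<ge>k. good_run l N \<sigma> ?w n" for k
    proof -
      obtain a b where ab: "rt k \<le> a" "a \<le> b" "real (Suc N) * l \<le> \<sigma> * (W b \<omega> - W a \<omega>)"
        and steady: "\<And>u v. a \<le> u \<Longrightarrow> u \<le> v \<Longrightarrow> v \<le> b \<Longrightarrow> - (l / 2) \<le> \<sigma> * (W v \<omega> - W u \<omega>)"
        using rises[OF rt_nonneg[of k]] by blast
      have "0 \<le> a" using ab(1) rt_nonneg[of k] by linarith
      from steady_rise_steps[OF this ab(2) \<sigma> steady ab(3)]
      obtain n where n: "a \<le> rt n" "\<And>i. i \<in> {n..<n + N} \<Longrightarrow> l / 2 \<le> \<sigma> * (W (rt (Suc i)) \<omega> - W (rt i) \<omega>)"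
        by blast
      \<comment> \<open>Since \<open>rt k \<le> a \<le> rt n\<close>, starting the rise after
        \<open>rt k\<close> makes the index of the run at least \<open>k\<close>.\<close>
      then have "k \<le> n" using rt_strict_mono[of n k] ab(1) by (meson leD leI order_trans)
      then show ?thesis using n(2) by (auto simp: good_run_iff)
    qed
    from good_time_flow[OF \<sigma> N this] show ?case
      unfolding S_def random_flow_def by blast
  qed
  ultimately show ?thesis by (intro exI[of _ S]) blast
qed

end

theorem proposition1:
  fixes l :: real and mp mm :: "real measure" and M :: "'a measure"
    and Up Um :: "real \<Rightarrow> real \<Rightarrow> 'a \<Rightarrow> real" and W :: "real \<Rightarrow> 'a \<Rightarrow> real"
  assumes l: "0 < l" "l \<le> pi"
    and mp: "mp \<in> space (prob_algebra unit_interval)" "(\<integral>x. x \<partial>mp) = 1/2"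
    and mm: "mm \<in> space (prob_algebra unit_interval)" "(\<integral>x. x \<partial>mm) = 1/2"
    and M: "prob_space M"
    and driving: "prob_space.driving_processes M mp mm Up Um W"
  shows "(\<exists>S :: nat \<Rightarrow> 'a \<Rightarrow> ennreal.
            (\<forall>k\<ge>1. stopping_time (\<lambda>t. FW (space M) W 0 (enn2ereal t)) (S k)) \<and>
            (\<forall>\<omega>\<in>space M. mono_on {1..} (\<lambda>k. S k \<omega>)) \<and>
            (AE \<omega> in M. ((\<lambda>k. S k \<omega>) \<longlonglongrightarrow> \<infinity>) \<and>
               (\<forall>k\<ge>1. S k \<omega> < \<infinity> \<and>
                  (\<forall>z\<in>sphere 0 1.
                     random_flow l Up Um W \<omega> 0 (enn2real (S k \<omega>)) z = return circle (cis l))))) \<and>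
         (\<exists>T :: nat \<Rightarrow> 'a \<Rightarrow> ennreal.
            (\<forall>k\<ge>1. stopping_time (\<lambda>t. FW (space M) W 0 (enn2ereal t)) (T k)) \<and>
            (\<forall>\<omega>\<in>space M. mono_on {1..} (\<lambda>k. T k \<omega>)) \<and>
            (AE \<omega> in M. ((\<lambda>k. T k \<omega>) \<longlonglongrightarrow> \<infinity>) \<and>
               (\<forall>k\<ge>1. T k \<omega> < \<infinity> \<and>
                  (\<forall>z\<in>sphere 0 1.
                     random_flow l Up Um W \<omega> 0 (enn2real (T k \<omega>)) z = return circle 1))))"
proof -
  interpret prob_space M by (rule M)
  have bm: "standard_brownian_motion W"
    using driving unfolding driving_processes_def brownian_motion_on_line_def by blast
  have measurable: "\<forall>s t. s \<le> t \<longrightarrow> U s t \<in> M \<rightarrow>\<^sub>M unit_interval" if "splitting_process ext m W U" for ext m U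
    using that unfolding splitting_process_def Let_def by (rule conjunct1)
  have "splitting_process path_inf mp W Up" "splitting_process path_sup mm W Um"
    using driving unfolding driving_processes_def by blast+
  from this[THEN measurable]
  have "Up s t \<in> M \<rightarrow>\<^sub>M unit_interval" "Um s t \<in> M \<rightarrow>\<^sub>M unit_interval" if "s \<le> t" for s t
    using that by blast+
  moreover have "space unit_interval = {0..1}" by (simp add: unit_interval_def space_restrict_space)
  ultimately have U: "Up s t \<omega> \<in> {0..1}" "Um s t \<omega> \<in> {0..1}" if "s \<le> t" "\<omega> \<in> space M" for s t \<omega>
    using that measurable_space by metis+
  have target: "target l 1 = cis l" "target l (- 1) = 1" by (simp_all add: target_def)
  have \<sigma>: "1 \<in> {1, - 1 :: real}" "- 1 \<in> {1, - 1 :: real}" by auto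
  show ?thesis
    using coalescence_times[OF bm \<sigma>(1) l U] coalescence_times[OF bm \<sigma>(2) l U]
    unfolding target by (rule conjI)
qed

end
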